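(* Let $k$ be a non-zero commutative ring, $G$ a group, $\sigma:G\times G\to k^\times$ a group two-cocycle (for the trivial action), and let $A=k\langle x_1,\dots,x_n\rangle/(p_i)_{i\in I}$ be a $G$-graded $k$-algebra generated by homogeneous elements $x_j$ of degree $g_j\in G$ ($1\le j\le n$), with relations $p_i=0$ ($i\in I$); assume that the $k$-submodule of $k\langle x_1,\dots,x_n\rangle$ spanned by the $p_i$ is a graded submodule for the $G$-grading of $k\langle x_1,\dots,x_n\rangle$ in which $x_j$ has degree $g_j$. Then the twisted algebra ${}_\sigma A$ is presented as $${}_\sigma A=k\langle X_1,\dots,X_n\rangle/(\kappa(p_i))_{i\in I},$$ where $X_j$ corresponds to $x_j$ viewed as an element of ${}_\sigma A$. If moreover $G$ is abelian and if the commutativity relation $x_ix_j=x_jx_i$ (for some $i\ne j$) holds in $A$, then in ${}_\sigma A$ one has $$X_iX_j=b_\sigma(g_j,g_i)\,X_jX_i .$$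
   Context: A $G$-graded $k$-algebra is the same as a left comodule algebra over the group algebra $k[G]$ (with $\Delta(g)=g\otimes g$). The group two-cocycle $\sigma$ satisfies $\sigma(g,h)\sigma(gh,l)=\sigma(h,l)\sigma(g,hl)$. The twisted algebra ${}_\sigma A$ is the $G$-graded algebra with underlying graded module $A$, with product determined by $a*_\sigma b=\sigma(g,h)\,ab$ for $a,b$ homogeneous of degrees $g,h$, and with unit $\sigma(1,1)^{-1}1_A$. The generator $x_j$ seen as an element of ${}_\sigma A$ is written $X_j$, and words in the $X_j$ refer to the product $*_\sigma$. For $r>1$ and $1\le i_1,\dots,i_r\le n$ put $$\kappa_{i_1,\dots,i_r}=\sigma(g_{i_1},g_{i_2})^{-1}\sigma(g_{i_1}g_{i_2},g_{i_3})^{-1}\cdots\sigma(g_{i_1}g_{i_2}\cdots g_{i_{r-1}},g_{i_r})^{-1}.$$ The linear isomorphism $\kappa:k\langle x_1,\dots,x_n\rangle\to k\langle X_1,\dots,X_n\rangle$ is given by $\kappa(x_{i_1}\cdots x_{i_r})=\kappa_{i_1,\dots,i_r}X_{i_1}\cdots X_{i_r}$ for $r>1$, $\kappa(x_j)=X_j$, $\kappa(1)=\sigma(1,1)$. For $G$ abelian, $b_\sigma(g,h)=\sigma(h,g)/\sigma(g,h)$. *)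

theory Defs
  imports "HOL-Algebra.Module" "HOL-Algebra.QuotRing"
begin

section \<open>Associative algebras\<close>

text \<open>The library locale \<^locale>\<open>algebra\<close> requires the algebra itself to be commutative; here only
  the scalars commute.\<close>

locale assoc_algebra = module R M + ring M for R and M (structure) +
  assumes smult_assoc_left:
      "\<lbrakk> c \<in> carrier R; x \<in> carrier M; y \<in> carrier M \<rbrakk> \<Longrightarrow>
       (c \<odot>\<^bsub>M\<^esub> x) \<otimes>\<^bsub>M\<^esub> y = c \<odot>\<^bsub>M\<^esub> (x \<otimes>\<^bsub>M\<^esub> y)"
    and smult_assoc_right:
      "\<lbrakk> c \<in> carrier R; x \<in> carrier M; y \<in> carrier M \<rbrakk> \<Longrightarrow>
       x \<otimes>\<^bsub>M\<^esub> (c \<odot>\<^bsub>M\<^esub> y) = c \<odot>\<^bsub>M\<^esub> (x \<otimes>\<^bsub>M\<^esub> y)"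

definition algebra_iso ::
  "('k, 'm) ring_scheme \<Rightarrow> ('k, 'a, 'c) module_scheme \<Rightarrow> ('k, 'b, 'd) module_scheme \<Rightarrow> ('a \<Rightarrow> 'b) set"
  where "algebra_iso k A B =
    {\<phi> \<in> ring_iso A B. \<forall>c\<in>carrier k. \<forall>a\<in>carrier A. \<phi> (c \<odot>\<^bsub>A\<^esub> a) = c \<odot>\<^bsub>B\<^esub> \<phi> a}"

text \<open>The library quotient ring \<open>A Quot I\<close> together with the induced scalar multiplication
  \<open>c \<odot> (I + a) = I + c \<odot> a\<close>, written without choosing a representative.\<close>

definition quotient_algebra ::
  "('k, 'a, 'c) module_scheme \<Rightarrow> 'a set \<Rightarrow> ('k, 'a set) module"
  where "quotient_algebra A I = ring.extend (A Quot I)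
    \<lparr> smult = (\<lambda>c S. \<Union>a\<in>S. I +>\<^bsub>A\<^esub> (c \<odot>\<^bsub>A\<^esub> a)) \<rparr>"

section \<open>Free algebras and presentations\<close>

text \<open>Words in the letters of \<open>X\<close> are lists, and \<open>f w\<close> is the coefficient of the word \<open>w\<close> in \<open>f\<close>.\<close>

definition free_algebra :: "('k, 'm) ring_scheme \<Rightarrow> 'x set \<Rightarrow> ('k, 'x list \<Rightarrow> 'k) module"
  where "free_algebra k X =
    \<lparr> carrier = {f. (\<forall>w. f w \<in> carrier k) \<and> finite {w. f w \<noteq> \<zero>\<^bsub>k\<^esub>} \<and>
        (\<forall>w. f w \<noteq> \<zero>\<^bsub>k\<^esub> \<longrightarrow> w \<in> lists X)},
      mult = (\<lambda>f f' w. finsum k (\<lambda>s. f (take s w) \<otimes>\<^bsub>k\<^esub> f' (drop s w)) {..length w}),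
      one = (\<lambda>w. if w = [] then \<one>\<^bsub>k\<^esub> else \<zero>\<^bsub>k\<^esub>),
      zero = (\<lambda>w. \<zero>\<^bsub>k\<^esub>),
      add = (\<lambda>f f' w. f w \<oplus>\<^bsub>k\<^esub> f' w),
      smult = (\<lambda>c f w. c \<otimes>\<^bsub>k\<^esub> f w) \<rparr>"

definition free_gen :: "('k, 'm) ring_scheme \<Rightarrow> 'x \<Rightarrow> 'x list \<Rightarrow> 'k"
  where "free_gen k j = (\<lambda>w. if w = [j] then \<one>\<^bsub>k\<^esub> else \<zero>\<^bsub>k\<^esub>)"

text \<open>\<open>is_presentation k X P A x\<close>: the \<open>k\<close>-algebra \<open>A\<close> is \<open>k\<langle>X\<rangle>/(P)\<close>, the class of the generator
  \<open>j \<in> X\<close> corresponding to the element \<open>x j\<close> of \<open>A\<close>. Ideals are two-sided.\<close>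

definition is_presentation ::
  "('k, 'm) ring_scheme \<Rightarrow> 'x set \<Rightarrow> ('x list \<Rightarrow> 'k) set \<Rightarrow> ('k, 'a, 'c) module_scheme \<Rightarrow> ('x \<Rightarrow> 'a) \<Rightarrow> bool"
  where "is_presentation k X P A x \<longleftrightarrow>
    assoc_algebra k A \<and> P \<subseteq> carrier (free_algebra k X) \<and>
    (let F = free_algebra k X; I = Idl\<^bsub>F\<^esub> P in
      \<exists>\<phi> \<in> algebra_iso k (quotient_algebra F I) A. \<forall>j\<in>X. \<phi> (I +>\<^bsub>F\<^esub> free_gen k j) = x j)"

section \<open>Gradings\<close>

text \<open>A family \<open>D h\<close> (\<open>h \<in> carrier G\<close>) of subsets is given; \<open>c h\<close> is the degree \<open>h\<close> part of \<open>a\<close>.\<close>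

definition homogeneous_decomp ::
  "('g, 'n) monoid_scheme \<Rightarrow> ('a, 'c) ring_scheme \<Rightarrow> ('g \<Rightarrow> 'a set) \<Rightarrow> 'a \<Rightarrow> ('g \<Rightarrow> 'a) \<Rightarrow> bool"
  where "homogeneous_decomp G A D a c \<longleftrightarrow>
    (\<forall>h\<in>carrier G. c h \<in> D h) \<and> (\<forall>h. h \<notin> carrier G \<longrightarrow> c h = \<zero>\<^bsub>A\<^esub>) \<and>
    finite {h. c h \<noteq> \<zero>\<^bsub>A\<^esub>} \<and> a = finsum A c {h. c h \<noteq> \<zero>\<^bsub>A\<^esub>}"

definition component ::
  "('g, 'n) monoid_scheme \<Rightarrow> ('a, 'c) ring_scheme \<Rightarrow> ('g \<Rightarrow> 'a set) \<Rightarrow> 'a \<Rightarrow> 'g \<Rightarrow> 'a"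
  where "component G A D a = (THE c. homogeneous_decomp G A D a c)"

locale graded_algebra = assoc_algebra k A + G?: group G
  for k (structure) and A (structure) and G (structure) +
  fixes D :: "'g \<Rightarrow> 'a set"
  assumes comp_submodule: "h \<in> carrier G \<Longrightarrow> submodule (D h) k A"
    and direct_sum: "a \<in> carrier A \<Longrightarrow> \<exists>!c. homogeneous_decomp G A D a c"
    and mult_degree: "\<lbrakk> g \<in> carrier G; h \<in> carrier G; a \<in> D g; b \<in> D h \<rbrakk> \<Longrightarrow> a \<otimes>\<^bsub>A\<^esub> b \<in> D (g \<otimes>\<^bsub>G\<^esub> h)"
    and one_degree: "\<one>\<^bsub>A\<^esub> \<in> D \<one>\<^bsub>G\<^esub>"

definition graded_submodule ::
  "('k, 'm) ring_scheme \<Rightarrow> ('g, 'n) monoid_scheme \<Rightarrow> ('k, 'a, 'c) module_scheme \<Rightarrow> ('g \<Rightarrow> 'a set) \<Rightarrow> 'a set \<Rightarrow> bool"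
  where "graded_submodule k G A D N \<longleftrightarrow>
    submodule N k A \<and> (\<forall>a\<in>N. \<forall>h\<in>carrier G. component G A D a h \<in> N)"

definition module_span :: "('k, 'm) ring_scheme \<Rightarrow> ('k, 'a, 'c) module_scheme \<Rightarrow> 'a set \<Rightarrow> 'a set"
  where "module_span k M S = \<Inter>{N. submodule N k M \<and> S \<subseteq> N}"

definition word_degree :: "('g, 'n) monoid_scheme \<Rightarrow> ('x \<Rightarrow> 'g) \<Rightarrow> 'x list \<Rightarrow> 'g"
  where "word_degree G g w = foldr (\<otimes>\<^bsub>G\<^esub>) (map g w) \<one>\<^bsub>G\<^esub>"

definition free_grading ::
  "('k, 'm) ring_scheme \<Rightarrow> ('g, 'n) monoid_scheme \<Rightarrow> 'x set \<Rightarrow> ('x \<Rightarrow> 'g) \<Rightarrow> 'g \<Rightarrow> ('x list \<Rightarrow> 'k) set"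
  where "free_grading k G X g h =
    {f \<in> carrier (free_algebra k X). \<forall>w. f w \<noteq> \<zero>\<^bsub>k\<^esub> \<longrightarrow> word_degree G g w = h}"

section \<open>Two-cocycles and twisted algebras\<close>

definition group_two_cocycle ::
  "('k, 'm) ring_scheme \<Rightarrow> ('g, 'n) monoid_scheme \<Rightarrow> ('g \<Rightarrow> 'g \<Rightarrow> 'k) \<Rightarrow> bool"
  where "group_two_cocycle k G \<sigma> \<longleftrightarrow>
    (\<forall>g\<in>carrier G. \<forall>h\<in>carrier G. \<sigma> g h \<in> Units k) \<and>
    (\<forall>g\<in>carrier G. \<forall>h\<in>carrier G. \<forall>l\<in>carrier G.
      \<sigma> g h \<otimes>\<^bsub>k\<^esub> \<sigma> (g \<otimes>\<^bsub>G\<^esub> h) l = \<sigma> h l \<otimes>\<^bsub>k\<^esub> \<sigma> g (h \<otimes>\<^bsub>G\<^esub> l))"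

text \<open>The bilinear extension of \<open>a * b = \<sigma> g h \<odot> (a \<otimes> b)\<close> from homogeneous \<open>a\<close>, \<open>b\<close> of degrees
  \<open>g\<close>, \<open>h\<close>.\<close>

definition twisted_algebra ::
  "('k, 'm) ring_scheme \<Rightarrow> ('g, 'n) monoid_scheme \<Rightarrow> ('g \<Rightarrow> 'g \<Rightarrow> 'k) \<Rightarrow> ('k, 'a, 'c) module_scheme \<Rightarrow> ('g \<Rightarrow> 'a set)
    \<Rightarrow> ('k, 'a, 'c) module_scheme"
  where "twisted_algebra k G \<sigma> A D = A
    \<lparr> mult := (\<lambda>a b.
        finsum A (\<lambda>g.
          finsum A (\<lambda>h. \<sigma> g h \<odot>\<^bsub>A\<^esub> (component G A D a g \<otimes>\<^bsub>A\<^esub> component G A D b h))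
            {h. component G A D b h \<noteq> \<zero>\<^bsub>A\<^esub>})
          {g. component G A D a g \<noteq> \<zero>\<^bsub>A\<^esub>}),
      one := inv\<^bsub>k\<^esub> (\<sigma> \<one>\<^bsub>G\<^esub> \<one>\<^bsub>G\<^esub>) \<odot>\<^bsub>A\<^esub> \<one>\<^bsub>A\<^esub> \<rparr>"

lemma (in graded_algebra) component_homogeneous:
  assumes g: "g \<in> carrier G" and a: "a \<in> D g"
  shows "component G A D a = (\<lambda>h. if h = g then a else \<zero>\<^bsub>A\<^esub>)"
proof -
  let ?c = "\<lambda>h. if h = g then a else \<zero>\<^bsub>A\<^esub>"
  have sub: "D h \<subseteq> carrier A" "\<zero>\<^bsub>A\<^esub> \<in> D h" if "h \<in> carrier G" for h
    using comp_submodule[OF that] subgroup.subset subgroup.one_closed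
    by (fastforce simp: submodule_def)+
  have aA: "a \<in> carrier A" using sub g a by blast
  have supp: "{h. ?c h \<noteq> \<zero>\<^bsub>A\<^esub>} = (if a = \<zero>\<^bsub>A\<^esub> then {} else {g})" by auto
  have "homogeneous_decomp G A D a ?c"
    unfolding homogeneous_decomp_def supp using sub g a aA by auto
  then show ?thesis
    unfolding component_def using direct_sum[OF aA] by (blast intro: the1_equality)
qed

lemma (in graded_algebra) twisted_mult_homogeneous:
  assumes g: "g \<in> carrier G" and h: "h \<in> carrier G"
    and a: "a \<in> D g" and b: "b \<in> D h" and \<sigma>: "\<sigma> g h \<in> carrier k"
  shows "a \<otimes>\<^bsub>twisted_algebra k G \<sigma> A D\<^esub> b = \<sigma> g h \<odot>\<^bsub>A\<^esub> (a \<otimes>\<^bsub>A\<^esub> b)"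
proof -
  have sub: "D l \<subseteq> carrier A" if "l \<in> carrier G" for l
    using comp_submodule[OF that] subgroup.subset by (fastforce simp: submodule_def)
  have aA: "a \<in> carrier A" and bA: "b \<in> carrier A" using sub g h a b by blast+
  have supp: "{l. l = d \<and> (l = d \<longrightarrow> y \<noteq> \<zero>\<^bsub>A\<^esub>)} = (if y = \<zero>\<^bsub>A\<^esub> then {} else {d})" for d :: 'g and y
    by auto
  show ?thesis
    using aA bA \<sigma>
    by (simp add: twisted_algebra_def component_homogeneous[OF g a] component_homogeneous[OF h b] supp
        smult_r_null)
qed

section \<open>The coefficients and the map \<open>\<kappa>\<close>\<close>

definition kappa_coeff ::
  "('k, 'm) ring_scheme \<Rightarrow> ('g, 'n) monoid_scheme \<Rightarrow> ('g \<Rightarrow> 'g \<Rightarrow> 'k) \<Rightarrow> ('x \<Rightarrow> 'g) \<Rightarrow> 'x list \<Rightarrow> 'k"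
  where "kappa_coeff k G \<sigma> g w =
    (if w = [] then \<sigma> \<one>\<^bsub>G\<^esub> \<one>\<^bsub>G\<^esub>
     else finprod k (\<lambda>s. inv\<^bsub>k\<^esub> (\<sigma> (word_degree G g (take s w)) (g (w ! s)))) {1..<length w})"

text \<open>\<open>\<kappa>\<close> is diagonal in the basis of words. Words of length 1 have coefficient 1 (empty product).
  The case distinction keeps \<open>\<kappa> f\<close> zero on words with letters outside the generating set, where the
  coefficient need not lie in the carrier of \<open>k\<close>.\<close>

definition kappa ::
  "('k, 'm) ring_scheme \<Rightarrow> ('g, 'n) monoid_scheme \<Rightarrow> ('g \<Rightarrow> 'g \<Rightarrow> 'k) \<Rightarrow> ('x \<Rightarrow> 'g) \<Rightarrow> ('x list \<Rightarrow> 'k) \<Rightarrow> 'x list \<Rightarrow> 'k"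
  where "kappa k G \<sigma> g f =
    (\<lambda>w. if f w = \<zero>\<^bsub>k\<^esub> then \<zero>\<^bsub>k\<^esub> else kappa_coeff k G \<sigma> g w \<otimes>\<^bsub>k\<^esub> f w)"

definition b_sigma ::
  "('k, 'm) ring_scheme \<Rightarrow> ('g \<Rightarrow> 'g \<Rightarrow> 'k) \<Rightarrow> 'g \<Rightarrow> 'g \<Rightarrow> 'k"
  where "b_sigma k \<sigma> g h = \<sigma> h g \<otimes>\<^bsub>k\<^esub> inv\<^bsub>k\<^esub> (\<sigma> g h)"

end

theory Submission
  imports Defs
begin

text \<open>Let \<open>F\<close> be the free algebra, graded by the degrees of words, and \<open>\<pi> : F \<rightarrow> A\<close> the surjection
  with kernel \<open>I\<close>, the ideal generated by the relations \<open>P\<close>. Twisting leaves the module \<open>A\<close>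
  unchanged, so \<open>\<pi>' = \<pi> \<circ> \<kappa>\<^sup>-\<^sup>1\<close> is a surjective linear map onto the twisted algebra with kernel
  \<open>\<kappa>(I)\<close>. The theorem amounts to two facts: \<open>\<pi>'\<close> is multiplicative for the twisted product, and
  \<open>\<kappa>(I)\<close> is the ideal \<open>J\<close> generated by \<open>\<kappa>(P)\<close>.

  Both rest on one identity for words \<open>u\<close>, \<open>v\<close> of degrees \<open>p\<close>, \<open>q\<close>, namely \<open>\<sigma>(p,q) \<kappa>\<^sub>u\<^sub>v = \<kappa>\<^sub>u
  \<kappa>\<^sub>v\<close> (\<open>kappa_coeff_append\<close>), which follows from the cocycle identity by adding the letters of
  \<open>v\<close> one at a time. It says that \<open>\<kappa>\<close> is an algebra isomorphism from the twist of \<open>F\<close> to \<open>F\<close>.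
  Multiplicativity of \<open>\<pi>'\<close> (\<open>hom_twist\<close>) is checked on monomials: the image of a word of degree
  \<open>p\<close> under \<open>\<pi>\<close> is a product of the \<open>x\<^sub>j\<close> and so homogeneous of degree \<open>p\<close>, and the twisted
  product of homogeneous elements is the product scaled by \<open>\<sigma>(p,q)\<close>.

  For the kernel, \<open>J \<subseteq> \<kappa>(I)\<close> holds because \<open>\<kappa>(I)\<close>, being the kernel of a homomorphism, is an
  ideal containing \<open>\<kappa>(P)\<close>. The converse is where the grading of the span of \<open>P\<close> enters
  (\<open>kappa_genideal\<close>). The preimage \<open>\<kappa>\<^sup>-\<^sup>1(J)\<close> is not obviously an ideal, since \<open>\<kappa>\<close> respects
  products only up to scalars depending on degrees. The elements all of whose homogeneous
  components lie in \<open>\<kappa>\<^sup>-\<^sup>1(J)\<close> do form an ideal (\<open>ideal_kappa_parts\<close>): components can be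
  multiplied by homogeneous elements, where the scalar is a single unit. This ideal contains \<open>P\<close>,
  because the components of a relation lie in the span of \<open>P\<close>, hence it contains \<open>I\<close>.

  The commutation rule compares the scalars \<open>\<sigma>(g\<^sub>i,g\<^sub>j)\<close> and \<open>\<sigma>(g\<^sub>j,g\<^sub>i)\<close> of the two twisted
  products \<open>X\<^sub>iX\<^sub>j\<close> and \<open>X\<^sub>jX\<^sub>i\<close>.\<close>

section \<open>The free algebra\<close>

definition monomial :: "('k, 'm) ring_scheme \<Rightarrow> 'k \<Rightarrow> 'x list \<Rightarrow> 'x list \<Rightarrow> 'k"
  where "monomial k c w = (\<lambda>u. if u = w then c else \<zero>\<^bsub>k\<^esub>)"

locale free_algebra_on = k?: cring k for k (structure) +
  fixes X :: "'x set" and F (structure)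
  defines F_def: "F \<equiv> free_algebra k X"
begin

text \<open>These rules turn the module operations into operations on coefficients. Arguments that treat
  \<open>F\<close> as an abstract algebra switch them off.\<close>
lemma F_simps [simp]:
  "\<zero>\<^bsub>F\<^esub> = (\<lambda>w. \<zero>)"
  "f \<oplus>\<^bsub>F\<^esub> f' = (\<lambda>w. f w \<oplus> f' w)"
  "c \<odot>\<^bsub>F\<^esub> f = (\<lambda>w. c \<otimes> f w)"
  "\<one>\<^bsub>F\<^esub> = monomial k \<one> []"
  by (simp_all add: F_def free_algebra_def monomial_def)

lemma mult_F: "f \<otimes>\<^bsub>F\<^esub> f' = (\<lambda>w. \<Oplus>s\<in>{..length w}. f (take s w) \<otimes> f' (drop s w))"
  by (simp add: F_def free_algebra_def)

lemma carrier_F: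
  "f \<in> carrier F \<longleftrightarrow>
    (\<forall>w. f w \<in> carrier k) \<and> finite {w. f w \<noteq> \<zero>} \<and> (\<forall>w. f w \<noteq> \<zero> \<longrightarrow> w \<in> lists X)"
  by (simp add: F_def free_algebra_def)

lemma coeff_closed [simp]: "f \<in> carrier F \<Longrightarrow> f w \<in> carrier k"
  by (simp add: carrier_F)

lemma coeff_outside: "f \<in> carrier F \<Longrightarrow> w \<notin> lists X \<Longrightarrow> f w = \<zero>"
  unfolding carrier_F by blast

lemma carrier_F_supportI:
  assumes "finite S" "\<And>w. f w \<in> carrier k" "\<And>w. f w \<noteq> \<zero> \<Longrightarrow> w \<in> S" "S \<subseteq> lists X"
  shows "f \<in> carrier F"
proof -
  have "finite {w. f w \<noteq> \<zero>}" by (rule finite_subset[OF _ assms(1)]) (use assms(3) in blast)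
  then show ?thesis unfolding carrier_F using assms(2-4) by blast
qed

lemma support_F: "f \<in> carrier F \<Longrightarrow> finite {w. f w \<noteq> \<zero>} \<and> {w. f w \<noteq> \<zero>} \<subseteq> lists X"
  unfolding carrier_F by blast

lemma monomial_closed [simp]: "c \<in> carrier k \<Longrightarrow> w \<in> lists X \<Longrightarrow> monomial k c w \<in> carrier F"
  by (rule carrier_F_supportI[of "{w}"]) (auto simp: monomial_def split: if_splits)

lemma module_F: "module k F"
proof (rule moduleI)
  show "cring k" by (rule k.is_cring)
  have add: "(\<lambda>w. f w \<oplus> f' w) \<in> carrier F" if f: "f \<in> carrier F" "f' \<in> carrier F" for f f'
    by (rule carrier_F_supportI[of "{w. f w \<noteq> \<zero>} \<union> {w. f' w \<noteq> \<zero>}"])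
      (use f in \<open>auto simp: support_F\<close>)
  have neg: "(\<lambda>w. \<ominus> f w) \<in> carrier F" if f: "f \<in> carrier F" for f
    by (rule carrier_F_supportI[of "{w. f w \<noteq> \<zero>}"])
      (use f in \<open>auto simp: support_F\<close>)
  show "abelian_group F"
  proof (rule abelian_groupI)
    show "\<zero>\<^bsub>F\<^esub> \<in> carrier F" by (simp add: carrier_F)
    show "\<exists>f'\<in>carrier F. f' \<oplus>\<^bsub>F\<^esub> f = \<zero>\<^bsub>F\<^esub>" if "f \<in> carrier F" for f
      using neg[OF that] that by (auto simp: k.l_neg intro!: bexI[of _ "\<lambda>w. \<ominus> f w"])
  qed (auto simp: add k.a_ac)
  show "c \<odot>\<^bsub>F\<^esub> f \<in> carrier F" if "c \<in> carrier k" "f \<in> carrier F" for c f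
    by (rule carrier_F_supportI[of "{w. f w \<noteq> \<zero>}"])
      (use that in \<open>auto simp: support_F\<close>)
qed (auto simp: k.l_distr k.r_distr k.m_assoc)

sublocale F: module k F
  by (rule module_F)

text \<open>Elements of the free algebra are finite sums of monomials, so additive statements need only be
  checked on monomials. Taking for \<open>W\<close> the words of one degree gives the same principle for
  homogeneous elements.\<close>

lemma monomial_induct_on [consumes 2, case_names zero monomial add]:
  assumes f: "f \<in> carrier F" and W: "{w. f w \<noteq> \<zero>} \<subseteq> W"
    and zero: "P \<zero>\<^bsub>F\<^esub>"
    and monomial: "\<And>c w. c \<in> carrier k \<Longrightarrow> w \<in> lists X \<Longrightarrow> w \<in> W \<Longrightarrow> P (monomial k c w)"
    and add: "\<And>a b. a \<in> carrier F \<Longrightarrow> b \<in> carrier F \<Longrightarrow> P a \<Longrightarrow> P b \<Longrightarrow> P (a \<oplus>\<^bsub>F\<^esub> b)"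
  shows "P f"
proof -
  have "P f" if "finite S" "S \<subseteq> W \<inter> lists X" "f \<in> carrier F" "{w. f w \<noteq> \<zero>} \<subseteq> S" for S f
    using that
  proof (induction S arbitrary: f)
    case empty
    then have "f = \<zero>\<^bsub>F\<^esub>" by auto
    then show ?case using zero by simp
  next
    case (insert w S)
    let ?r = "f(w := \<zero>)"
    have r: "?r \<in> carrier F"
      by (rule carrier_F_supportI[of S]) (use insert in \<open>auto split: if_splits\<close>)
    have m: "monomial k (f w) w \<in> carrier F" using insert by simp
    have "P ?r" by (rule insert.IH[OF _ r]) (use insert in auto)
    moreover have "P (monomial k (f w) w)" using insert by (intro monomial) auto
    moreover have "f = monomial k (f w) w \<oplus>\<^bsub>F\<^esub> ?r"
      using insert.prems by (auto simp: monomial_def fun_eq_iff)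
    ultimately show ?case using add[OF m r] by metis
  qed
  from this[of "{w. f w \<noteq> \<zero>}" f] show ?thesis using f W support_F by blast
qed

lemmas monomial_induct = monomial_induct_on[where W = UNIV, OF _ subset_UNIV,
  consumes 1, case_names zero monomial add]

lemma mult_closed: assumes f: "f \<in> carrier F" "f' \<in> carrier F" shows "f \<otimes>\<^bsub>F\<^esub> f' \<in> carrier F"
proof (rule carrier_F_supportI[of "(\<lambda>(u, v). u @ v) ` ({w. f w \<noteq> \<zero>} \<times> {w. f' w \<noteq> \<zero>})"
      "f \<otimes>\<^bsub>F\<^esub> f'"])
  show "(f \<otimes>\<^bsub>F\<^esub> f') w \<in> carrier k" for w using f by (simp add: mult_F)
  show "w \<in> (\<lambda>(u, v). u @ v) ` ({w. f w \<noteq> \<zero>} \<times> {w. f' w \<noteq> \<zero>})" if "(f \<otimes>\<^bsub>F\<^esub> f') w \<noteq> \<zero>" for w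
  proof -
    have "\<exists>s. f (take s w) \<otimes> f' (drop s w) \<noteq> \<zero>"
    proof (rule ccontr)
      assume "\<nexists>s. f (take s w) \<otimes> f' (drop s w) \<noteq> \<zero>"
      then have "(f \<otimes>\<^bsub>F\<^esub> f') w = \<zero>" by (simp add: mult_F)
      with that show False by contradiction
    qed
    then obtain s where "f (take s w) \<otimes> f' (drop s w) \<noteq> \<zero>" by blast
    then have "f (take s w) \<noteq> \<zero>" "f' (drop s w) \<noteq> \<zero>" using f by auto
    then show ?thesis by (auto intro!: image_eqI[of _ _ "(take s w, drop s w)"])
  qed
qed (use f support_F in \<open>fastforce+\<close>)

lemma mult_add_left:
  assumes "a \<in> carrier F" "b \<in> carrier F" "f \<in> carrier F"
  shows "(a \<oplus>\<^bsub>F\<^esub> b) \<otimes>\<^bsub>F\<^esub> f = a \<otimes>\<^bsub>F\<^esub> f \<oplus>\<^bsub>F\<^esub> b \<otimes>\<^bsub>F\<^esub> f"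
  using assms by (simp add: mult_F k.l_distr k.finsum_addf Pi_def)

lemma mult_add_right:
  assumes "a \<in> carrier F" "b \<in> carrier F" "f \<in> carrier F"
  shows "f \<otimes>\<^bsub>F\<^esub> (a \<oplus>\<^bsub>F\<^esub> b) = f \<otimes>\<^bsub>F\<^esub> a \<oplus>\<^bsub>F\<^esub> f \<otimes>\<^bsub>F\<^esub> b"
  using assms by (simp add: mult_F k.r_distr k.finsum_addf Pi_def)

lemma mult_smult:
  assumes "c \<in> carrier k" "a \<in> carrier F" "b \<in> carrier F"
  shows "(c \<odot>\<^bsub>F\<^esub> a) \<otimes>\<^bsub>F\<^esub> b = c \<odot>\<^bsub>F\<^esub> (a \<otimes>\<^bsub>F\<^esub> b)" "a \<otimes>\<^bsub>F\<^esub> (c \<odot>\<^bsub>F\<^esub> b) = c \<odot>\<^bsub>F\<^esub> (a \<otimes>\<^bsub>F\<^esub> b)"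
  using assms by (simp_all add: mult_F k.finsum_rdistr Pi_def k.m_ac)

lemma mult_zero: "f \<in> carrier F \<Longrightarrow> f \<otimes>\<^bsub>F\<^esub> \<zero>\<^bsub>F\<^esub> = \<zero>\<^bsub>F\<^esub>" "f \<in> carrier F \<Longrightarrow> \<zero>\<^bsub>F\<^esub> \<otimes>\<^bsub>F\<^esub> f = \<zero>\<^bsub>F\<^esub>"
  by (simp_all add: mult_F)

text \<open>Of all cuts of the word \<open>w\<close> in the convolution sum, only the one after \<open>length u\<close> letters can
  give \<open>u\<close> as the first half.\<close>
lemma mult_monomial:
  assumes c: "c \<in> carrier k" "d \<in> carrier k"
  shows "monomial k c u \<otimes>\<^bsub>F\<^esub> monomial k d v = monomial k (c \<otimes> d) (u @ v)"
proof
  fix w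
  let ?t = "\<lambda>s. monomial k c u (take s w) \<otimes> monomial k d v (drop s w)"
  have t: "?t s = (if length u = s then (if w = u @ v then c \<otimes> d else \<zero>) else \<zero>)" if "s \<le> length w" for s
    using that c append_take_drop_id[of s w] by (auto simp: monomial_def)
  have "(\<Oplus>s\<in>{..length w}. ?t s)
      = (\<Oplus>s\<in>{..length w}. if length u = s then (if w = u @ v then c \<otimes> d else \<zero>) else \<zero>)"
    by (rule k.finsum_cong') (use t c in auto)
  also have "\<dots> = (if w = u @ v then c \<otimes> d else \<zero>)"
    using c k.finsum_singleton[of "length u" "{..length w}" "\<lambda>_. c \<otimes> d"] by (cases "w = u @ v") simp_all
  also have "\<dots> = monomial k (c \<otimes> d) (u @ v) w" by (simp add: monomial_def)
  finally show "(monomial k c u \<otimes>\<^bsub>F\<^esub> monomial k d v) w = monomial k (c \<otimes> d) (u @ v) w"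
    by (simp only: mult_F)
qed

lemma one_closed: "\<one>\<^bsub>F\<^esub> \<in> carrier F"
  by simp

lemma mult_one: assumes f: "f \<in> carrier F" shows "\<one>\<^bsub>F\<^esub> \<otimes>\<^bsub>F\<^esub> f = f" "f \<otimes>\<^bsub>F\<^esub> \<one>\<^bsub>F\<^esub> = f"
proof -
  note [simp del] = F_simps(1-3)
  have one: "monomial k \<one> [] \<in> carrier F" by simp
  have "f \<in> carrier F \<Longrightarrow> \<one>\<^bsub>F\<^esub> \<otimes>\<^bsub>F\<^esub> f = f \<and> f \<otimes>\<^bsub>F\<^esub> \<one>\<^bsub>F\<^esub> = f"
    by (induction f rule: monomial_induct)
      (auto simp: mult_zero mult_monomial mult_add_left mult_add_right one)
  then show "\<one>\<^bsub>F\<^esub> \<otimes>\<^bsub>F\<^esub> f = f" "f \<otimes>\<^bsub>F\<^esub> \<one>\<^bsub>F\<^esub> = f" using f by blast+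
qed

text \<open>Both sides are additive in each factor, and on monomials the claim is associativity of
  concatenation. This avoids rearranging a triple convolution sum.\<close>
lemma mult_assoc:
  assumes a: "a \<in> carrier F" and b: "b \<in> carrier F" and c: "c \<in> carrier F"
  shows "(a \<otimes>\<^bsub>F\<^esub> b) \<otimes>\<^bsub>F\<^esub> c = a \<otimes>\<^bsub>F\<^esub> (b \<otimes>\<^bsub>F\<^esub> c)"
proof -
  note [simp del] = F_simps
  note [simp] = mult_closed mult_zero mult_add_left mult_add_right mult_monomial k.m_assoc
  have 1: "(monomial k r u \<otimes>\<^bsub>F\<^esub> monomial k s v) \<otimes>\<^bsub>F\<^esub> c = monomial k r u \<otimes>\<^bsub>F\<^esub> (monomial k s v \<otimes>\<^bsub>F\<^esub> c)"
    if [simp]: "r \<in> carrier k" "s \<in> carrier k" "u \<in> lists X" "v \<in> lists X" for r s u v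
    using c
  proof (induction c rule: monomial_induct)
    case (add a b)
    have "monomial k (r \<otimes> s) (u @ v) \<in> carrier F" "monomial k r u \<in> carrier F" "monomial k s v \<in> carrier F"
      by simp_all
    then show ?case using add by (simp del: monomial_closed)
  qed auto
  have 2: "(monomial k r u \<otimes>\<^bsub>F\<^esub> b) \<otimes>\<^bsub>F\<^esub> c = monomial k r u \<otimes>\<^bsub>F\<^esub> (b \<otimes>\<^bsub>F\<^esub> c)"
    if [simp]: "r \<in> carrier k" "u \<in> lists X" for r u
    using b by (induction b rule: monomial_induct) (use c 1 in auto)
  show ?thesis
    using a by (induction a rule: monomial_induct) (use b c 2 in auto)
qed

theorem assoc_algebra_F: "assoc_algebra k F"
proof -
  note [simp del] = F_simps
  have "ring F"
  proof (rule ringI)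
    show "abelian_group F" by (rule F.abelian_group_axioms)
    show "monoid F"
      by (rule monoidI) (simp_all add: mult_closed mult_assoc mult_one one_closed)
  qed (auto simp: mult_add_left mult_add_right)
  then show ?thesis
    by (intro assoc_algebra.intro module_F assoc_algebra_axioms.intro) (auto simp: mult_smult)
qed

sublocale F: assoc_algebra k F
  by (rule assoc_algebra_F)

end

section \<open>Presentations as surjective homomorphisms\<close>

text \<open>Ideals are defined for the ring structure only; they are submodules because
  \<open>c \<odot> a = (c \<odot> \<one>) \<otimes> a\<close>.\<close>
lemma (in assoc_algebra) ideal_smult_closed:
  assumes I: "ideal I M" and c: "c \<in> carrier R" and a: "a \<in> I"
  shows "c \<odot>\<^bsub>M\<^esub> a \<in> I"
proof -
  have aM: "a \<in> carrier M" using I a by (rule ideal.Icarr)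
  then have "c \<odot>\<^bsub>M\<^esub> a = (c \<odot>\<^bsub>M\<^esub> \<one>\<^bsub>M\<^esub>) \<otimes>\<^bsub>M\<^esub> a" using c by (simp add: smult_assoc_left)
  then show ?thesis using ideal.I_l_closed[OF I a] c by simp
qed

lemma (in assoc_algebra) quotient_algebra_smult:
  assumes I: "ideal I M" and c: "c \<in> carrier R" and a: "a \<in> carrier M"
  shows "c \<odot>\<^bsub>quotient_algebra M I\<^esub> (I +>\<^bsub>M\<^esub> a) = I +>\<^bsub>M\<^esub> (c \<odot>\<^bsub>M\<^esub> a)"
proof -
  interpret I: ideal I M by fact
  have "I +>\<^bsub>M\<^esub> (c \<odot>\<^bsub>M\<^esub> b) = I +>\<^bsub>M\<^esub> (c \<odot>\<^bsub>M\<^esub> a)" if b: "b \<in> I +>\<^bsub>M\<^esub> a" for b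
  proof -
    obtain i where i: "i \<in> I" "b = i \<oplus>\<^bsub>M\<^esub> a" using b by (auto simp: a_r_coset_def')
    then have "c \<odot>\<^bsub>M\<^esub> b = c \<odot>\<^bsub>M\<^esub> i \<oplus>\<^bsub>M\<^esub> c \<odot>\<^bsub>M\<^esub> a" using c a I.Icarr by (simp add: smult_r_distr)
    then have "c \<odot>\<^bsub>M\<^esub> b \<in> I +>\<^bsub>M\<^esub> (c \<odot>\<^bsub>M\<^esub> a)"
      using ideal_smult_closed[OF I c i(1)] by (auto simp: a_r_coset_def')
    from I.a_repr_independence'[OF this smult_closed[OF c a]] show ?thesis by (rule sym)
  qed
  moreover have "a \<in> I +>\<^bsub>M\<^esub> a" using a by (rule I.a_rcos_self)
  ultimately have "(\<Union>b\<in>I +>\<^bsub>M\<^esub> a. I +>\<^bsub>M\<^esub> (c \<odot>\<^bsub>M\<^esub> b)) = I +>\<^bsub>M\<^esub> (c \<odot>\<^bsub>M\<^esub> a)"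
    by blast
  then show ?thesis by (simp add: quotient_algebra_def ring.defs)
qed

lemma quotient_algebra_simps [simp]:
  "carrier (quotient_algebra M I) = carrier (M Quot I)"
  "\<one>\<^bsub>quotient_algebra M I\<^esub> = \<one>\<^bsub>M Quot I\<^esub>"
  "S \<otimes>\<^bsub>quotient_algebra M I\<^esub> T = S \<otimes>\<^bsub>M Quot I\<^esub> T"
  "S \<oplus>\<^bsub>quotient_algebra M I\<^esub> T = S \<oplus>\<^bsub>M Quot I\<^esub> T"
  by (simp_all add: quotient_algebra_def ring.defs)

lemma ring_iso_quotient_algebra: "ring_iso (quotient_algebra M I) B = ring_iso (M Quot I) B"
  by (simp add: ring_iso_def ring_hom_def)

context free_algebra_on
begin

lemma free_gen_eq_monomial: "free_gen k j = monomial k \<one> [j]"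
  by (simp add: free_gen_def monomial_def)

text \<open>By the first isomorphism theorem, a presentation is the same as a surjective algebra
  homomorphism from the free algebra whose kernel is generated by the relations. The two directions
  let the rest of the proof avoid cosets.\<close>
lemma is_presentationI:
  assumes B: "assoc_algebra k B" and P: "P \<subseteq> carrier F"
    and hom: "\<pi> \<in> ring_hom F B"
    and lin: "\<And>c f. c \<in> carrier k \<Longrightarrow> f \<in> carrier F \<Longrightarrow> \<pi> (c \<odot>\<^bsub>F\<^esub> f) = c \<odot>\<^bsub>B\<^esub> \<pi> f"
    and surj: "\<pi> ` carrier F = carrier B"
    and ker: "{f \<in> carrier F. \<pi> f = \<zero>\<^bsub>B\<^esub>} = Idl\<^bsub>F\<^esub> P"
    and gen: "\<And>j. j \<in> X \<Longrightarrow> \<pi> (monomial k \<one> [j]) = x j"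
  shows "is_presentation k X P B x"
proof -
  interpret B: assoc_algebra k B by (rule B)
  interpret \<pi>: ring_hom_ring F B \<pi>
    by (rule ring_hom_ringI2[OF F.ring_axioms B.ring_axioms hom])
  have I: "a_kernel F B \<pi> = Idl\<^bsub>F\<^esub> P" unfolding a_kernel_def' by (rule ker)
  have id: "ideal (Idl\<^bsub>F\<^esub> P) F" using P by (rule F.genideal_ideal)
  let ?\<phi> = "\<lambda>S. the_elem (\<pi> ` S)"
  have \<phi>: "?\<phi> (Idl\<^bsub>F\<^esub> P +>\<^bsub>F\<^esub> f) = \<pi> f" if "f \<in> carrier F" for f
    using \<pi>.the_elem_simp[OF that] I by simp
  have "?\<phi> \<in> algebra_iso k (quotient_algebra F (Idl\<^bsub>F\<^esub> P)) B"
  proof -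
    have "?\<phi> \<in> ring_iso (F Quot (Idl\<^bsub>F\<^esub> P)) B"
      using \<pi>.FactRing_iso_set[OF surj] I by simp
    moreover have "?\<phi> (c \<odot>\<^bsub>quotient_algebra F (Idl\<^bsub>F\<^esub> P)\<^esub> S) = c \<odot>\<^bsub>B\<^esub> ?\<phi> S"
      if c: "c \<in> carrier k" and S: "S \<in> carrier (F Quot (Idl\<^bsub>F\<^esub> P))" for c S
    proof -
      obtain f where f: "f \<in> carrier F" and Sf: "S = Idl\<^bsub>F\<^esub> P +>\<^bsub>F\<^esub> f"
        using S by (auto simp: FactRing_def A_RCOSETS_def')
      show ?thesis
        using lin[OF c f] F.smult_closed[OF c f] unfolding Sf F.quotient_algebra_smult[OF id c f]
        by (simp only: \<phi> f)
    qed
    ultimately show ?thesis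
      unfolding algebra_iso_def ring_iso_quotient_algebra by simp
  qed
  moreover have "?\<phi> (Idl\<^bsub>F\<^esub> P +>\<^bsub>F\<^esub> free_gen k j) = x j" if "j \<in> X" for j
    using gen[OF that] \<phi>[of "monomial k \<one> [j]"] that by (simp add: free_gen_eq_monomial)
  ultimately show ?thesis
    unfolding is_presentation_def Let_def F_def[symmetric]
    by (intro conjI B P bexI[of _ ?\<phi>] ballI)
qed

lemma is_presentationE:
  assumes pres: "is_presentation k X P B x"
  obtains \<pi> where "\<pi> \<in> ring_hom F B"
    and "\<And>c f. c \<in> carrier k \<Longrightarrow> f \<in> carrier F \<Longrightarrow> \<pi> (c \<odot>\<^bsub>F\<^esub> f) = c \<odot>\<^bsub>B\<^esub> \<pi> f"
    and "\<pi> ` carrier F = carrier B"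
    and "{f \<in> carrier F. \<pi> f = \<zero>\<^bsub>B\<^esub>} = Idl\<^bsub>F\<^esub> P"
    and "\<And>j. j \<in> X \<Longrightarrow> \<pi> (monomial k \<one> [j]) = x j"
proof -
  let ?I = "Idl\<^bsub>F\<^esub> P"
  obtain \<phi> where B: "assoc_algebra k B" and P: "P \<subseteq> carrier F"
    and iso: "\<phi> \<in> algebra_iso k (quotient_algebra F ?I) B"
    and gen: "\<And>j. j \<in> X \<Longrightarrow> \<phi> (?I +>\<^bsub>F\<^esub> free_gen k j) = x j"
    using pres unfolding is_presentation_def Let_def F_def[symmetric] by blast
  interpret B: assoc_algebra k B by (rule B)
  have id: "ideal ?I F" using P by (rule F.genideal_ideal)
  interpret I: ideal ?I F by (rule id)
  let ?\<pi> = "\<lambda>f. \<phi> (?I +>\<^bsub>F\<^esub> f)"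
  have riso: "\<phi> \<in> ring_iso (F Quot ?I) B"
    using iso unfolding algebra_iso_def ring_iso_quotient_algebra by simp
  have bij: "bij_betw \<phi> (carrier (F Quot ?I)) (carrier B)" using riso by (simp add: ring_iso_def)
  have carr: "carrier (F Quot ?I) = (\<lambda>f. ?I +>\<^bsub>F\<^esub> f) ` carrier F"
    by (auto simp: FactRing_def A_RCOSETS_def')
  have hom: "?\<pi> \<in> ring_hom F B"
    using ring_hom_trans[OF I.rcos_ring_hom, of \<phi> B] riso by (simp add: ring_iso_def comp_def)
  interpret \<pi>: ring_hom_ring F B ?\<pi>
    by (rule ring_hom_ringI2[OF F.ring_axioms B.ring_axioms hom])
  have cos_mem: "?I +>\<^bsub>F\<^esub> f \<in> carrier (F Quot ?I)" if "f \<in> carrier F" for f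
    unfolding carr by (rule imageI) (rule that)
  have cos_zero: "?I +>\<^bsub>F\<^esub> \<zero>\<^bsub>F\<^esub> = ?I"
    by (rule F.a_coset_join2[OF F.zero_closed I.a_subgroup I.zero_closed])
  have zero_iff: "?\<pi> f = \<zero>\<^bsub>B\<^esub> \<longleftrightarrow> f \<in> ?I" if f: "f \<in> carrier F" for f
  proof -
    have "?\<pi> f = \<zero>\<^bsub>B\<^esub> \<longleftrightarrow> ?\<pi> f = ?\<pi> \<zero>\<^bsub>F\<^esub>" by (simp only: \<pi>.hom_zero)
    also have "\<dots> \<longleftrightarrow> ?I +>\<^bsub>F\<^esub> f = ?I +>\<^bsub>F\<^esub> \<zero>\<^bsub>F\<^esub>"
      by (rule inj_on_eq_iff[OF bij_betw_imp_inj_on[OF bij] cos_mem[OF f] cos_mem[OF F.zero_closed]])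
    also have "\<dots> \<longleftrightarrow> f \<in> ?I"
      unfolding cos_zero
      using F.a_coset_join1[OF _ f I.a_subgroup] F.a_coset_join2[OF f I.a_subgroup] by (rule iffI)
    finally show ?thesis .
  qed
  have ker: "{f \<in> carrier F. ?\<pi> f = \<zero>\<^bsub>B\<^esub>} = ?I"
  proof (rule subset_antisym; rule subsetI)
    fix f assume "f \<in> {f \<in> carrier F. ?\<pi> f = \<zero>\<^bsub>B\<^esub>}"
    then have "f \<in> carrier F \<and> ?\<pi> f = \<zero>\<^bsub>B\<^esub>" by (rule CollectD)
    then show "f \<in> ?I" by (elim conjE) (rule iffD1[OF zero_iff])
  next
    fix f assume f: "f \<in> ?I"
    show "f \<in> {f \<in> carrier F. ?\<pi> f = \<zero>\<^bsub>B\<^esub>}"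
      by (rule CollectI, rule conjI[OF I.Icarr[OF f] iffD2[OF zero_iff[OF I.Icarr[OF f]] f]])
  qed
  have lin: "?\<pi> (c \<odot>\<^bsub>F\<^esub> f) = c \<odot>\<^bsub>B\<^esub> ?\<pi> f" if c: "c \<in> carrier k" and f: "f \<in> carrier F" for c f
  proof -
    have "\<forall>c\<in>carrier k. \<forall>S\<in>carrier (F Quot ?I). \<phi> (c \<odot>\<^bsub>quotient_algebra F ?I\<^esub> S) = c \<odot>\<^bsub>B\<^esub> \<phi> S"
      using iso unfolding algebra_iso_def quotient_algebra_simps(1) by (elim CollectE conjE)
    from this[rule_format, OF c cos_mem[OF f]] show ?thesis
      unfolding F.quotient_algebra_smult[OF id c f] .
  qed
  have surj: "?\<pi> ` carrier F = carrier B"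
    using bij_betw_imp_surj_on[OF bij] unfolding carr image_image .
  have gen': "?\<pi> (monomial k \<one> [j]) = x j" if "j \<in> X" for j
    using gen[OF that] unfolding free_gen_eq_monomial .
  show ?thesis
    by (rule that[OF hom lin surj ker gen'])
qed

end

section \<open>The twisted algebra is an associative algebra\<close>

locale twisted_graded_algebra = k: cring k + A: assoc_algebra k A + G: group G +
    graded: graded_algebra k A G D
  for k (structure) and A (structure) and G (structure) and D +
  fixes \<sigma> :: "'d \<Rightarrow> 'd \<Rightarrow> 'a" and T (structure)
  assumes cocycle: "group_two_cocycle k G \<sigma>"
  defines T_def: "T \<equiv> twisted_algebra k G \<sigma> A D"
begin

lemma \<sigma>_Units: "g \<in> carrier G \<Longrightarrow> h \<in> carrier G \<Longrightarrow> \<sigma> g h \<in> Units k"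
  using cocycle by (simp add: group_two_cocycle_def)

lemma \<sigma>_closed [simp]: "g \<in> carrier G \<Longrightarrow> h \<in> carrier G \<Longrightarrow> \<sigma> g h \<in> carrier k"
  using \<sigma>_Units k.Units_closed by blast

lemma \<sigma>_cocycle:
  assumes "g \<in> carrier G" "h \<in> carrier G" "l \<in> carrier G"
  shows "\<sigma> g h \<otimes>\<^bsub>k\<^esub> \<sigma> (g \<otimes>\<^bsub>G\<^esub> h) l = \<sigma> h l \<otimes>\<^bsub>k\<^esub> \<sigma> g (h \<otimes>\<^bsub>G\<^esub> l)"
  using cocycle assms by (simp add: group_two_cocycle_def)

lemma T_simps [simp]:
  "carrier T = carrier A" "\<zero>\<^bsub>T\<^esub> = \<zero>\<^bsub>A\<^esub>" "a \<oplus>\<^bsub>T\<^esub> b = a \<oplus>\<^bsub>A\<^esub> b" "c \<odot>\<^bsub>T\<^esub> a = c \<odot>\<^bsub>A\<^esub> a"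
  "\<one>\<^bsub>T\<^esub> = inv\<^bsub>k\<^esub> (\<sigma> \<one>\<^bsub>G\<^esub> \<one>\<^bsub>G\<^esub>) \<odot>\<^bsub>A\<^esub> \<one>\<^bsub>A\<^esub>"
  by (simp_all add: T_def twisted_algebra_def)

lemma D_carrier: "h \<in> carrier G \<Longrightarrow> a \<in> D h \<Longrightarrow> a \<in> carrier A"
  using A.submoduleE(1)[OF graded.comp_submodule] by blast

lemma D_smult: "h \<in> carrier G \<Longrightarrow> c \<in> carrier k \<Longrightarrow> a \<in> D h \<Longrightarrow> c \<odot>\<^bsub>A\<^esub> a \<in> D h"
  using A.submoduleE(4)[OF graded.comp_submodule] by blast

lemma D_add: "h \<in> carrier G \<Longrightarrow> a \<in> D h \<Longrightarrow> b \<in> D h \<Longrightarrow> a \<oplus>\<^bsub>A\<^esub> b \<in> D h"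
  using A.submoduleE(5)[OF graded.comp_submodule] by blast

abbreviation cmp where "cmp \<equiv> component G A D"

lemma homogeneous_decomp_cmp: "a \<in> carrier A \<Longrightarrow> homogeneous_decomp G A D a (cmp a)"
  unfolding component_def using graded.direct_sum by (rule theI')

lemma cmp_D: "a \<in> carrier A \<Longrightarrow> h \<in> carrier G \<Longrightarrow> cmp a h \<in> D h"
  using homogeneous_decomp_cmp unfolding homogeneous_decomp_def by blast

lemma cmp_outside: "a \<in> carrier A \<Longrightarrow> h \<notin> carrier G \<Longrightarrow> cmp a h = \<zero>\<^bsub>A\<^esub>"
  using homogeneous_decomp_cmp unfolding homogeneous_decomp_def by blast

lemma cmp_closed [simp]: "a \<in> carrier A \<Longrightarrow> cmp a h \<in> carrier A"
  using cmp_D cmp_outside D_carrier by (cases "h \<in> carrier G") auto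

definition supp where "supp a = {h. cmp a h \<noteq> \<zero>\<^bsub>A\<^esub>}"

lemma supp: "a \<in> carrier A \<Longrightarrow> finite (supp a)" "a \<in> carrier A \<Longrightarrow> supp a \<subseteq> carrier G"
  using homogeneous_decomp_cmp cmp_outside unfolding homogeneous_decomp_def supp_def by blast+

text \<open>Components are defined by a sum over the exact support. Supports shrink under cancellation, so
  it is easier to verify a decomposition over any finite set that contains the support.\<close>
lemma cmp_eqI:
  assumes c: "\<And>h. h \<in> carrier G \<Longrightarrow> c h \<in> D h" "\<And>h. h \<notin> carrier G \<Longrightarrow> c h = \<zero>\<^bsub>A\<^esub>"
    and S: "finite S" "\<And>h. c h \<noteq> \<zero>\<^bsub>A\<^esub> \<Longrightarrow> h \<in> S" and a: "a = finsum A c S"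
  shows "cmp a = c"
proof -
  have closed: "c h \<in> carrier A" for h using c D_carrier by (cases "h \<in> carrier G") auto
  have fin: "finite {h. c h \<noteq> \<zero>\<^bsub>A\<^esub>}" by (rule finite_subset[OF _ S(1)]) (use S(2) in blast)
  have "finsum A c {h. c h \<noteq> \<zero>\<^bsub>A\<^esub>} = finsum A c S"
    by (rule A.add.finprod_mono_neutral_cong_left) (use S closed in auto)
  then have "homogeneous_decomp G A D a c"
    unfolding homogeneous_decomp_def using c fin a by simp
  moreover have "a \<in> carrier A" using a closed by auto
  ultimately show ?thesis
    unfolding component_def using graded.direct_sum by (blast intro: the1_equality)
qed

lemma finsum_cmp:
  assumes "a \<in> carrier A" "finite S" "supp a \<subseteq> S"
  shows "finsum A (cmp a) S = a"
proof -
  have "finsum A (cmp a) (supp a) = finsum A (cmp a) S"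
    by (rule A.add.finprod_mono_neutral_cong_left) (use assms in \<open>auto simp: supp_def\<close>)
  moreover have "a = finsum A (cmp a) (supp a)"
    using homogeneous_decomp_cmp[OF assms(1)] unfolding homogeneous_decomp_def supp_def by blast
  ultimately show ?thesis by simp
qed

lemma cmp_add:
  assumes a: "a \<in> carrier A" "b \<in> carrier A"
  shows "cmp (a \<oplus>\<^bsub>A\<^esub> b) = (\<lambda>h. cmp a h \<oplus>\<^bsub>A\<^esub> cmp b h)"
proof (rule cmp_eqI[of _ "supp a \<union> supp b"])
  show "a \<oplus>\<^bsub>A\<^esub> b = (\<Oplus>\<^bsub>A\<^esub>h\<in>supp a \<union> supp b. cmp a h \<oplus>\<^bsub>A\<^esub> cmp b h)"
    using a finsum_cmp[of _ "supp a \<union> supp b"] by (simp add: A.finsum_addf supp)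
qed (use a supp in \<open>auto simp: D_add cmp_D cmp_outside supp_def\<close>)

lemma cmp_zero: "cmp \<zero>\<^bsub>A\<^esub> = (\<lambda>h. \<zero>\<^bsub>A\<^esub>)"
  using graded.component_homogeneous[OF G.one_closed, of "\<zero>\<^bsub>A\<^esub>"]
    D_smult[OF G.one_closed k.zero_closed graded.one_degree] by auto

lemma homogeneous_induct [consumes 1, case_names zero homogeneous add]:
  assumes a: "a \<in> carrier A"
    and zero: "P \<zero>\<^bsub>A\<^esub>"
    and hom: "\<And>h b. h \<in> carrier G \<Longrightarrow> b \<in> D h \<Longrightarrow> P b"
    and add: "\<And>b c. b \<in> carrier A \<Longrightarrow> c \<in> carrier A \<Longrightarrow> P b \<Longrightarrow> P c \<Longrightarrow> P (b \<oplus>\<^bsub>A\<^esub> c)"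
  shows "P a"
proof -
  have "P (finsum A (cmp a) S)" if "finite S" "S \<subseteq> carrier G" for S
    using that
  proof (induction S)
    case empty
    then show ?case using zero by simp
  next
    case (insert h S)
    have "P (cmp a h)" using hom[of h] cmp_D[OF a, of h] insert.prems by simp
    then show ?case using insert a add by simp
  qed
  from this[of "supp a"] show ?thesis using a finsum_cmp[of a "supp a"] supp by simp
qed

text \<open>Over any finite sets of degrees containing the supports the defining double sum is the same.
  Choosing common sets for several factors makes the product visibly bilinear.\<close>

lemma T_mult:
  assumes a: "a \<in> carrier A" and b: "b \<in> carrier A"
    and S: "finite S" "supp a \<subseteq> S" "S \<subseteq> carrier G" and U: "finite U" "supp b \<subseteq> U" "U \<subseteq> carrier G"
  shows "a \<otimes>\<^bsub>T\<^esub> b = (\<Oplus>\<^bsub>A\<^esub>g\<in>S. \<Oplus>\<^bsub>A\<^esub>h\<in>U. \<sigma> g h \<odot>\<^bsub>A\<^esub> (cmp a g \<otimes>\<^bsub>A\<^esub> cmp b h))"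
proof -
  have closed: "\<sigma> g h \<odot>\<^bsub>A\<^esub> (cmp a g \<otimes>\<^bsub>A\<^esub> cmp b h) \<in> carrier A" if "g \<in> S" "h \<in> U" for g h
    using that S U a b by (intro A.smult_closed A.m_closed \<sigma>_closed) auto
  have inner: "(\<Oplus>\<^bsub>A\<^esub>h\<in>supp b. \<sigma> g h \<odot>\<^bsub>A\<^esub> (cmp a g \<otimes>\<^bsub>A\<^esub> cmp b h))
      = (\<Oplus>\<^bsub>A\<^esub>h\<in>U. \<sigma> g h \<odot>\<^bsub>A\<^esub> (cmp a g \<otimes>\<^bsub>A\<^esub> cmp b h))" if g: "g \<in> S" for g
    by (rule A.add.finprod_mono_neutral_cong_left)
      (use U S g a closed in \<open>auto simp: supp_def subset_iff\<close>)
  have "a \<otimes>\<^bsub>T\<^esub> b = (\<Oplus>\<^bsub>A\<^esub>g\<in>supp a. \<Oplus>\<^bsub>A\<^esub>h\<in>supp b. \<sigma> g h \<odot>\<^bsub>A\<^esub> (cmp a g \<otimes>\<^bsub>A\<^esub> cmp b h))"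
    by (simp add: T_def twisted_algebra_def supp_def)
  also have "\<dots> = (\<Oplus>\<^bsub>A\<^esub>g\<in>S. \<Oplus>\<^bsub>A\<^esub>h\<in>U. \<sigma> g h \<odot>\<^bsub>A\<^esub> (cmp a g \<otimes>\<^bsub>A\<^esub> cmp b h))"
  proof (rule A.add.finprod_mono_neutral_cong_left)
    show "(\<Oplus>\<^bsub>A\<^esub>h\<in>U. \<sigma> g h \<odot>\<^bsub>A\<^esub> (cmp a g \<otimes>\<^bsub>A\<^esub> cmp b h)) = \<zero>\<^bsub>A\<^esub>" if "g \<in> S - supp a" for g
      by (rule A.add.finprod_one_eqI) (use that S U b in \<open>auto simp: supp_def subset_iff\<close>)
  qed (use S inner closed in \<open>auto intro!: A.finsum_closed\<close>)
  finally show ?thesis .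
qed

lemma T_mult_closed: "a \<in> carrier A \<Longrightarrow> b \<in> carrier A \<Longrightarrow> a \<otimes>\<^bsub>T\<^esub> b \<in> carrier A"
  using T_mult[of a b "supp a" "supp b"] supp
  by (auto intro!: A.finsum_closed A.smult_closed A.m_closed \<sigma>_closed)

lemma T_mult_zero: assumes "a \<in> carrier A" shows "a \<otimes>\<^bsub>T\<^esub> \<zero>\<^bsub>A\<^esub> = \<zero>\<^bsub>A\<^esub>" "\<zero>\<^bsub>A\<^esub> \<otimes>\<^bsub>T\<^esub> a = \<zero>\<^bsub>A\<^esub>"
proof -
  have "supp \<zero>\<^bsub>A\<^esub> = {}" by (simp add: supp_def cmp_zero)
  then show "a \<otimes>\<^bsub>T\<^esub> \<zero>\<^bsub>A\<^esub> = \<zero>\<^bsub>A\<^esub>" "\<zero>\<^bsub>A\<^esub> \<otimes>\<^bsub>T\<^esub> a = \<zero>\<^bsub>A\<^esub>"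
    using T_mult[of a "\<zero>\<^bsub>A\<^esub>" "supp a" "{}"] T_mult[of "\<zero>\<^bsub>A\<^esub>" a "{}" "supp a"] assms supp by simp_all
qed

lemma T_mult_add:
  assumes a: "a \<in> carrier A" and b: "b \<in> carrier A" and c: "c \<in> carrier A"
  shows "(a \<oplus>\<^bsub>A\<^esub> b) \<otimes>\<^bsub>T\<^esub> c = a \<otimes>\<^bsub>T\<^esub> c \<oplus>\<^bsub>A\<^esub> b \<otimes>\<^bsub>T\<^esub> c"
    and "c \<otimes>\<^bsub>T\<^esub> (a \<oplus>\<^bsub>A\<^esub> b) = c \<otimes>\<^bsub>T\<^esub> a \<oplus>\<^bsub>A\<^esub> c \<otimes>\<^bsub>T\<^esub> b"
proof -
  define S where "S = supp a \<union> supp b \<union> supp (a \<oplus>\<^bsub>A\<^esub> b)"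
  have S: "finite S" "S \<subseteq> carrier G" "supp a \<subseteq> S" "supp b \<subseteq> S" "supp (a \<oplus>\<^bsub>A\<^esub> b) \<subseteq> S"
    using a b supp unfolding S_def by auto
  have closed: "\<sigma> g h \<odot>\<^bsub>A\<^esub> (cmp x g \<otimes>\<^bsub>A\<^esub> cmp y h) \<in> carrier A"
    if "g \<in> carrier G" "h \<in> carrier G" "x \<in> carrier A" "y \<in> carrier A" for g h x y
    using that by simp
  have in_S: "g \<in> carrier G" if "g \<in> S" for g using that S by blast
  have in_c: "g \<in> carrier G" if "g \<in> supp c" for g using that supp c by blast
  note [simp] = in_S in_c supp S c a b A.finsum_addf A.l_distr A.r_distr A.smult_r_distr Pi_def
  have "(a \<oplus>\<^bsub>A\<^esub> b) \<otimes>\<^bsub>T\<^esub> c =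
      (\<Oplus>\<^bsub>A\<^esub>g\<in>S. \<Oplus>\<^bsub>A\<^esub>h\<in>supp c. \<sigma> g h \<odot>\<^bsub>A\<^esub> (cmp a g \<otimes>\<^bsub>A\<^esub> cmp c h) \<oplus>\<^bsub>A\<^esub> \<sigma> g h \<odot>\<^bsub>A\<^esub> (cmp b g \<otimes>\<^bsub>A\<^esub> cmp c h))"
    using T_mult[of "a \<oplus>\<^bsub>A\<^esub> b" c S "supp c"]
    by (simp add: cmp_add cong: A.finsum_cong del: A.finsum_addf)
  also have "\<dots> = a \<otimes>\<^bsub>T\<^esub> c \<oplus>\<^bsub>A\<^esub> b \<otimes>\<^bsub>T\<^esub> c"
    using T_mult[of a c S "supp c"] T_mult[of b c S "supp c"]
    by (simp cong: A.finsum_cong)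
  finally show "(a \<oplus>\<^bsub>A\<^esub> b) \<otimes>\<^bsub>T\<^esub> c = a \<otimes>\<^bsub>T\<^esub> c \<oplus>\<^bsub>A\<^esub> b \<otimes>\<^bsub>T\<^esub> c" .
  have "c \<otimes>\<^bsub>T\<^esub> (a \<oplus>\<^bsub>A\<^esub> b) =
      (\<Oplus>\<^bsub>A\<^esub>g\<in>supp c. \<Oplus>\<^bsub>A\<^esub>h\<in>S. \<sigma> g h \<odot>\<^bsub>A\<^esub> (cmp c g \<otimes>\<^bsub>A\<^esub> cmp a h) \<oplus>\<^bsub>A\<^esub> \<sigma> g h \<odot>\<^bsub>A\<^esub> (cmp c g \<otimes>\<^bsub>A\<^esub> cmp b h))"
    using T_mult[of c "a \<oplus>\<^bsub>A\<^esub> b" "supp c" S]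
    by (simp add: cmp_add cong: A.finsum_cong del: A.finsum_addf)
  also have "\<dots> = c \<otimes>\<^bsub>T\<^esub> a \<oplus>\<^bsub>A\<^esub> c \<otimes>\<^bsub>T\<^esub> b"
    using T_mult[of c a "supp c" S] T_mult[of c b "supp c" S]
    by (simp cong: A.finsum_cong)
  finally show "c \<otimes>\<^bsub>T\<^esub> (a \<oplus>\<^bsub>A\<^esub> b) = c \<otimes>\<^bsub>T\<^esub> a \<oplus>\<^bsub>A\<^esub> c \<otimes>\<^bsub>T\<^esub> b" .
qed

lemma T_mult_homogeneous:
  assumes "g \<in> carrier G" "h \<in> carrier G" "a \<in> D g" "b \<in> D h"
  shows "a \<otimes>\<^bsub>T\<^esub> b = \<sigma> g h \<odot>\<^bsub>A\<^esub> (a \<otimes>\<^bsub>A\<^esub> b)"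
  unfolding T_def using assms by (intro graded.twisted_mult_homogeneous) simp_all

lemma T_mult_degree:
  assumes g: "g \<in> carrier G" and h: "h \<in> carrier G" and a: "a \<in> D g" and b: "b \<in> D h"
  shows "a \<otimes>\<^bsub>T\<^esub> b \<in> D (g \<otimes>\<^bsub>G\<^esub> h)"
  unfolding T_mult_homogeneous[OF assms]
  using graded.mult_degree[OF assms] g h by (intro D_smult) simp_all

text \<open>Scalars pass through the twisted product of homogeneous elements, where it is a scaled product
  in \<open>A\<close>; the general case follows by additivity in each factor.\<close>
lemma T_mult_smult:
  assumes c: "c \<in> carrier k" and a: "a \<in> carrier A" and b: "b \<in> carrier A"
  shows "(c \<odot>\<^bsub>A\<^esub> a) \<otimes>\<^bsub>T\<^esub> b = c \<odot>\<^bsub>A\<^esub> (a \<otimes>\<^bsub>T\<^esub> b)" "a \<otimes>\<^bsub>T\<^esub> (c \<odot>\<^bsub>A\<^esub> b) = c \<odot>\<^bsub>A\<^esub> (a \<otimes>\<^bsub>T\<^esub> b)"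
proof -
  note [simp] = T_mult_zero T_mult_add T_mult_closed D_carrier A.smult_r_distr c
  have hom: "(c \<odot>\<^bsub>A\<^esub> a) \<otimes>\<^bsub>T\<^esub> b = c \<odot>\<^bsub>A\<^esub> (a \<otimes>\<^bsub>T\<^esub> b) \<and> a \<otimes>\<^bsub>T\<^esub> (c \<odot>\<^bsub>A\<^esub> b) = c \<odot>\<^bsub>A\<^esub> (a \<otimes>\<^bsub>T\<^esub> b)"
    if "g \<in> carrier G" "h \<in> carrier G" "a \<in> D g" "b \<in> D h" for g h a b
    using that A.smult_assoc1[of c "\<sigma> g h" "a \<otimes>\<^bsub>A\<^esub> b"] A.smult_assoc1[of "\<sigma> g h" c "a \<otimes>\<^bsub>A\<^esub> b"]
    by (simp add: T_mult_homogeneous[of g h] D_smult A.smult_assoc_left A.smult_assoc_right k.m_comm)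
  have hom2: "(c \<odot>\<^bsub>A\<^esub> a) \<otimes>\<^bsub>T\<^esub> b = c \<odot>\<^bsub>A\<^esub> (a \<otimes>\<^bsub>T\<^esub> b) \<and> a \<otimes>\<^bsub>T\<^esub> (c \<odot>\<^bsub>A\<^esub> b) = c \<odot>\<^bsub>A\<^esub> (a \<otimes>\<^bsub>T\<^esub> b)"
    if g: "g \<in> carrier G" "a \<in> D g" for g a
    using b
  proof (induction b rule: homogeneous_induct)
    case (homogeneous h b)
    then show ?case using hom g by blast
  qed (use D_carrier[OF g] in auto)
  have "(c \<odot>\<^bsub>A\<^esub> a) \<otimes>\<^bsub>T\<^esub> b = c \<odot>\<^bsub>A\<^esub> (a \<otimes>\<^bsub>T\<^esub> b) \<and> a \<otimes>\<^bsub>T\<^esub> (c \<odot>\<^bsub>A\<^esub> b) = c \<odot>\<^bsub>A\<^esub> (a \<otimes>\<^bsub>T\<^esub> b)"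
    using a
  proof (induction a rule: homogeneous_induct)
    case (homogeneous h a)
    then show ?case using hom2 by blast
  qed (use b in auto)
  then show "(c \<odot>\<^bsub>A\<^esub> a) \<otimes>\<^bsub>T\<^esub> b = c \<odot>\<^bsub>A\<^esub> (a \<otimes>\<^bsub>T\<^esub> b)" "a \<otimes>\<^bsub>T\<^esub> (c \<odot>\<^bsub>A\<^esub> b) = c \<odot>\<^bsub>A\<^esub> (a \<otimes>\<^bsub>T\<^esub> b)"
    by auto
qed

text \<open>On homogeneous elements of degrees \<open>g\<close>, \<open>h\<close>, \<open>l\<close> the two bracketings carry the scalars
  \<open>\<sigma>(g,h) \<sigma>(gh,l)\<close> and \<open>\<sigma>(h,l) \<sigma>(g,hl)\<close>: associativity is the cocycle identity.\<close>

lemma T_mult_assoc: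
  assumes a: "a \<in> carrier A" and b: "b \<in> carrier A" and c: "c \<in> carrier A"
  shows "(a \<otimes>\<^bsub>T\<^esub> b) \<otimes>\<^bsub>T\<^esub> c = a \<otimes>\<^bsub>T\<^esub> (b \<otimes>\<^bsub>T\<^esub> c)"
proof -
  note [simp] = T_mult_zero T_mult_add T_mult_closed
  have 1: "(a \<otimes>\<^bsub>T\<^esub> b) \<otimes>\<^bsub>T\<^esub> c = a \<otimes>\<^bsub>T\<^esub> (b \<otimes>\<^bsub>T\<^esub> c)"
    if g: "g \<in> carrier G" "a \<in> D g" and h: "h \<in> carrier G" "b \<in> D h"
      and l: "l \<in> carrier G" "c \<in> D l" for a b c g h l
  proof -
    note carr = D_carrier[OF g] D_carrier[OF h] D_carrier[OF l]
    have "(a \<otimes>\<^bsub>T\<^esub> b) \<otimes>\<^bsub>T\<^esub> c = \<sigma> (g \<otimes>\<^bsub>G\<^esub> h) l \<odot>\<^bsub>A\<^esub> ((a \<otimes>\<^bsub>T\<^esub> b) \<otimes>\<^bsub>A\<^esub> c)"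
      using g h l T_mult_degree by (intro T_mult_homogeneous) simp_all
    also have "\<dots> = (\<sigma> g h \<otimes>\<^bsub>k\<^esub> \<sigma> (g \<otimes>\<^bsub>G\<^esub> h) l) \<odot>\<^bsub>A\<^esub> (a \<otimes>\<^bsub>A\<^esub> b \<otimes>\<^bsub>A\<^esub> c)"
      using g h l carr by (simp add: T_mult_homogeneous[of g h] A.smult_assoc_left A.smult_assoc1 k.m_comm[of "\<sigma> g h"])
    also have "\<dots> = (\<sigma> g (h \<otimes>\<^bsub>G\<^esub> l) \<otimes>\<^bsub>k\<^esub> \<sigma> h l) \<odot>\<^bsub>A\<^esub> (a \<otimes>\<^bsub>A\<^esub> (b \<otimes>\<^bsub>A\<^esub> c))"
      using g h l carr by (simp add: \<sigma>_cocycle A.m_assoc k.m_comm)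
    also have "\<dots> = \<sigma> g (h \<otimes>\<^bsub>G\<^esub> l) \<odot>\<^bsub>A\<^esub> (a \<otimes>\<^bsub>A\<^esub> (b \<otimes>\<^bsub>T\<^esub> c))"
      using g h l carr by (simp add: T_mult_homogeneous[of h l] A.smult_assoc_right A.smult_assoc1)
    also have "\<dots> = a \<otimes>\<^bsub>T\<^esub> (b \<otimes>\<^bsub>T\<^esub> c)"
      using g h l T_mult_degree by (intro T_mult_homogeneous[symmetric]) simp_all
    finally show ?thesis .
  qed
  have 2: "(a \<otimes>\<^bsub>T\<^esub> b) \<otimes>\<^bsub>T\<^esub> c = a \<otimes>\<^bsub>T\<^esub> (b \<otimes>\<^bsub>T\<^esub> c)"
    if g: "g \<in> carrier G" "a \<in> D g" and h: "h \<in> carrier G" "b \<in> D h" for a b g h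
    using c
  proof (induction c rule: homogeneous_induct)
    case (homogeneous l c)
    then show ?case using 1 g h by blast
  qed (use D_carrier[OF g] D_carrier[OF h] in simp_all)
  have 3: "(a \<otimes>\<^bsub>T\<^esub> b) \<otimes>\<^bsub>T\<^esub> c = a \<otimes>\<^bsub>T\<^esub> (b \<otimes>\<^bsub>T\<^esub> c)" if g: "g \<in> carrier G" "a \<in> D g" for a g
    using b
  proof (induction b rule: homogeneous_induct)
    case (homogeneous l b)
    then show ?case using 2 g by blast
  qed (use D_carrier[OF g] c in simp_all)
  show ?thesis
    using a
  proof (induction a rule: homogeneous_induct)
    case (homogeneous l a)
    then show ?case using 3 by blast
  qed (use b c in simp_all)
qed

text \<open>The cocycle identity at \<open>(1,1,g)\<close> and at \<open>(g,1,1)\<close>, after cancelling a unit. Hence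
  \<open>\<sigma>(1,1)\<^sup>-\<^sup>1 \<odot> 1\<close> is a unit element for the twisted product.\<close>
lemma \<sigma>_one:
  assumes g: "g \<in> carrier G"
  shows "\<sigma> \<one>\<^bsub>G\<^esub> g = \<sigma> \<one>\<^bsub>G\<^esub> \<one>\<^bsub>G\<^esub>" "\<sigma> g \<one>\<^bsub>G\<^esub> = \<sigma> \<one>\<^bsub>G\<^esub> \<one>\<^bsub>G\<^esub>"
proof -
  have "\<sigma> \<one>\<^bsub>G\<^esub> g \<otimes>\<^bsub>k\<^esub> \<sigma> \<one>\<^bsub>G\<^esub> \<one>\<^bsub>G\<^esub> = \<sigma> \<one>\<^bsub>G\<^esub> g \<otimes>\<^bsub>k\<^esub> \<sigma> \<one>\<^bsub>G\<^esub> g"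
    using \<sigma>_cocycle[of "\<one>\<^bsub>G\<^esub>" "\<one>\<^bsub>G\<^esub>" g] g by (simp add: k.m_comm)
  then show "\<sigma> \<one>\<^bsub>G\<^esub> g = \<sigma> \<one>\<^bsub>G\<^esub> \<one>\<^bsub>G\<^esub>"
    using k.Units_l_cancel[OF \<sigma>_Units[of "\<one>\<^bsub>G\<^esub>" g], of "\<sigma> \<one>\<^bsub>G\<^esub> \<one>\<^bsub>G\<^esub>" "\<sigma> \<one>\<^bsub>G\<^esub> g"] g by simp
  have "\<sigma> g \<one>\<^bsub>G\<^esub> \<otimes>\<^bsub>k\<^esub> \<sigma> g \<one>\<^bsub>G\<^esub> = \<sigma> g \<one>\<^bsub>G\<^esub> \<otimes>\<^bsub>k\<^esub> \<sigma> \<one>\<^bsub>G\<^esub> \<one>\<^bsub>G\<^esub>"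
    using \<sigma>_cocycle[of g "\<one>\<^bsub>G\<^esub>" "\<one>\<^bsub>G\<^esub>"] g by (simp add: k.m_comm)
  then show "\<sigma> g \<one>\<^bsub>G\<^esub> = \<sigma> \<one>\<^bsub>G\<^esub> \<one>\<^bsub>G\<^esub>"
    using k.Units_l_cancel[OF \<sigma>_Units[of g "\<one>\<^bsub>G\<^esub>"], of "\<sigma> g \<one>\<^bsub>G\<^esub>" "\<sigma> \<one>\<^bsub>G\<^esub> \<one>\<^bsub>G\<^esub>"] g by simp
qed

lemma T_one_degree: "\<one>\<^bsub>T\<^esub> \<in> D \<one>\<^bsub>G\<^esub>"
  using D_smult[OF G.one_closed _ graded.one_degree] \<sigma>_Units by simp

lemma T_mult_one:
  assumes a: "a \<in> carrier A"
  shows "\<one>\<^bsub>T\<^esub> \<otimes>\<^bsub>T\<^esub> a = a" "a \<otimes>\<^bsub>T\<^esub> \<one>\<^bsub>T\<^esub> = a"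
proof -
  note one = D_carrier[OF G.one_closed T_one_degree]
  let ?s = "\<sigma> \<one>\<^bsub>G\<^esub> \<one>\<^bsub>G\<^esub>"
  have s: "?s \<in> Units k" by (simp add: \<sigma>_Units)
  have hom: "\<one>\<^bsub>T\<^esub> \<otimes>\<^bsub>T\<^esub> a = a \<and> a \<otimes>\<^bsub>T\<^esub> \<one>\<^bsub>T\<^esub> = a" if g: "g \<in> carrier G" "a \<in> D g" for a g
  proof -
    have "?s \<odot>\<^bsub>A\<^esub> (inv\<^bsub>k\<^esub> ?s \<odot>\<^bsub>A\<^esub> a) = a"
      using s D_carrier[OF g] by (simp add: A.smult_assoc1[symmetric])
    then show ?thesis
      using g s D_carrier[OF g] T_one_degree
      by (simp add: T_mult_homogeneous[of "\<one>\<^bsub>G\<^esub>" g] T_mult_homogeneous[of g "\<one>\<^bsub>G\<^esub>"] \<sigma>_one[OF g(1)]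
          A.smult_assoc_left A.smult_assoc_right)
  qed
  have "\<one>\<^bsub>T\<^esub> \<otimes>\<^bsub>T\<^esub> a = a \<and> a \<otimes>\<^bsub>T\<^esub> \<one>\<^bsub>T\<^esub> = a"
    using a
  proof (induction a rule: homogeneous_induct)
    case (homogeneous h b)
    then show ?case using hom by blast
  qed (use one in \<open>simp_all add: T_mult_zero T_mult_add del: T_simps(5)\<close>)
  then show "\<one>\<^bsub>T\<^esub> \<otimes>\<^bsub>T\<^esub> a = a" "a \<otimes>\<^bsub>T\<^esub> \<one>\<^bsub>T\<^esub> = a" by auto
qed

theorem assoc_algebra_T: "assoc_algebra k T"
proof -
  have ab: "abelian_group T"
    by (rule abelian_groupI) (auto simp: A.a_ac intro: A.l_neg)
  have "ring T"
  proof (rule ringI[OF ab])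
    show "monoid T"
      by (rule monoidI)
        (simp_all add: T_mult_closed T_mult_assoc T_mult_one[simplified] \<sigma>_Units)
  qed (simp_all add: T_mult_add)
  moreover have "module k T"
    by (rule moduleI[OF k.is_cring ab]) (simp_all add: A.smult_l_distr A.smult_r_distr A.smult_assoc1)
  ultimately show ?thesis
    by (intro assoc_algebra.intro assoc_algebra_axioms.intro) (simp_all add: T_mult_smult)
qed

end

section \<open>Rescaling the words of a free algebra\<close>

context free_algebra_on
begin

text \<open>The map \<open>\<kappa>\<close> and its inverse are both diagonal in the basis of words. The value \<open>\<zero>\<close> where
  \<open>f w = \<zero>\<close> makes the coefficients of words outside the generating set irrelevant.\<close>
definition rescale :: "('x list \<Rightarrow> 'a) \<Rightarrow> ('x list \<Rightarrow> 'a) \<Rightarrow> 'x list \<Rightarrow> 'a"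
  where "rescale c f = (\<lambda>w. if f w = \<zero> then \<zero> else c w \<otimes> f w)"

lemma rescale_apply:
  assumes "f \<in> carrier F" "w \<in> lists X \<Longrightarrow> c w \<in> carrier k"
  shows "rescale c f w = (if w \<in> lists X then c w \<otimes> f w else \<zero>)"
  using assms coeff_outside[OF assms(1), of w] by (auto simp: rescale_def)

lemma rescale_closed:
  assumes f: "f \<in> carrier F" and c: "\<And>w. w \<in> lists X \<Longrightarrow> c w \<in> carrier k"
  shows "rescale c f \<in> carrier F"
proof (rule carrier_F_supportI[of "{w. f w \<noteq> \<zero>}"])
  show "rescale c f w \<in> carrier k" for w
    using rescale_apply[of f w c, OF f c] c f by simp
qed (use f support_F in \<open>auto simp: rescale_def split: if_splits\<close>)

lemma rescale_add:
  assumes f: "f \<in> carrier F" "f' \<in> carrier F" and c: "\<And>w. w \<in> lists X \<Longrightarrow> c w \<in> carrier k"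
  shows "rescale c (f \<oplus>\<^bsub>F\<^esub> f') = rescale c f \<oplus>\<^bsub>F\<^esub> rescale c f'"
proof
  fix w
  have s: "f \<oplus>\<^bsub>F\<^esub> f' \<in> carrier F" using f by (rule F.a_closed)
  show "rescale c (f \<oplus>\<^bsub>F\<^esub> f') w = (rescale c f \<oplus>\<^bsub>F\<^esub> rescale c f') w"
    using rescale_apply[of _ w c, OF s c] rescale_apply[of _ w c, OF f(1) c] rescale_apply[of _ w c, OF f(2) c] f c
    by (simp add: k.r_distr)
qed

lemma rescale_smult:
  assumes f: "f \<in> carrier F" and d: "d \<in> carrier k" and c: "\<And>w. w \<in> lists X \<Longrightarrow> c w \<in> carrier k"
  shows "rescale c (d \<odot>\<^bsub>F\<^esub> f) = d \<odot>\<^bsub>F\<^esub> rescale c f"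
proof
  fix w
  have s: "d \<odot>\<^bsub>F\<^esub> f \<in> carrier F" using d f by (rule F.smult_closed)
  show "rescale c (d \<odot>\<^bsub>F\<^esub> f) w = (d \<odot>\<^bsub>F\<^esub> rescale c f) w"
    using rescale_apply[of _ w c, OF s c] rescale_apply[of f w c, OF f c] f c d
    by (simp add: k.m_lcomm)
qed

lemma rescale_monomial:
  assumes "c w \<in> carrier k" "d \<in> carrier k"
  shows "rescale c (monomial k d w) = monomial k (c w \<otimes> d) w"
  using assms by (auto simp: rescale_def monomial_def fun_eq_iff)

lemma rescale_inverse:
  assumes f: "f \<in> carrier F" and c: "\<And>w. w \<in> lists X \<Longrightarrow> c w \<in> carrier k"
    and d: "\<And>w. w \<in> lists X \<Longrightarrow> d w \<in> carrier k"
    and inv: "\<And>w. w \<in> lists X \<Longrightarrow> c w \<otimes> d w = \<one>"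
  shows "rescale c (rescale d f) = f"
proof
  fix w
  have "c w \<otimes> (d w \<otimes> f w) = f w" if "w \<in> lists X"
    using c[OF that] d[OF that] inv[OF that] f by (simp add: k.m_assoc[symmetric])
  then show "rescale c (rescale d f) w = f w"
    using rescale_apply[of _ w c, OF rescale_closed[of f d, OF f d] c] rescale_apply[of f w d, OF f d] coeff_outside[OF f]
    by simp
qed

lemma smult_monomial:
  "c \<in> carrier k \<Longrightarrow> d \<in> carrier k \<Longrightarrow> c \<odot>\<^bsub>F\<^esub> monomial k d w = monomial k (c \<otimes> d) w"
  by (auto simp: monomial_def)

lemma finsum_F_apply:
  assumes "finite S" "\<And>h. h \<in> S \<Longrightarrow> c h \<in> carrier F"
  shows "finsum F c S w = (\<Oplus>h\<in>S. c h w)"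
  using assms
proof (induction S)
  case (insert h S)
  then have "finsum F c (insert h S) = c h \<oplus>\<^bsub>F\<^esub> finsum F c S"
    by (intro F.finsum_insert) auto
  then show ?case using insert by simp
qed simp

end

section \<open>Degrees of words and the coefficients of \<open>\<kappa>\<close>\<close>

locale twisted_presentation = free_algebra_on k X F + twisted_graded_algebra k A G D \<sigma> T
  for k (structure) and X and F (structure) and A (structure) and G (structure)
    and D and \<sigma> and T (structure) +
  fixes g
  assumes g_closed: "j \<in> X \<Longrightarrow> g j \<in> carrier G"
begin

abbreviation deg where "deg \<equiv> word_degree G g"
abbreviation coeff where "coeff \<equiv> kappa_coeff k G \<sigma> g"

lemma deg_simps [simp]: "deg [] = \<one>\<^bsub>G\<^esub>" "deg (j # w) = g j \<otimes>\<^bsub>G\<^esub> deg w"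
  by (simp_all add: word_degree_def)

lemma deg_closed [simp]: "w \<in> lists X \<Longrightarrow> deg w \<in> carrier G"
  by (induction w) (auto simp: g_closed)

lemma deg_append [simp]: "u \<in> lists X \<Longrightarrow> v \<in> lists X \<Longrightarrow> deg (u @ v) = deg u \<otimes>\<^bsub>G\<^esub> deg v"
  by (induction u) (auto simp: g_closed G.m_assoc simp del: in_lists_conv_set)

lemma kappa_coeff_Nil: "coeff [] = \<sigma> \<one>\<^bsub>G\<^esub> \<one>\<^bsub>G\<^esub>"
  by (simp add: kappa_coeff_def)

text \<open>For the empty word, where \<open>\<kappa>\<close> has the exceptional value \<open>\<sigma>(1,1)\<close>, the recursion holds
  because \<open>\<sigma>(1,g) = \<sigma>(1,1)\<close>. So the coefficients obey a single rule from the start.\<close>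
lemma kappa_coeff_snoc:
  assumes w: "w \<in> lists X" and j: "j \<in> X"
  shows "coeff (w @ [j]) = coeff w \<otimes>\<^bsub>k\<^esub> inv\<^bsub>k\<^esub> (\<sigma> (deg w) (g j))"
proof (cases "w = []")
  case True
  then show ?thesis
    using \<sigma>_one(1)[of "g j"] \<sigma>_Units[of "\<one>\<^bsub>G\<^esub>" "g j"] j g_closed by (simp add: kappa_coeff_def)
next
  case False
  let ?f = "\<lambda>u s. inv\<^bsub>k\<^esub> (\<sigma> (deg (take s u)) (g (u ! s)))"
  have closed: "?f w s \<in> carrier k" if "s < length w" for s
  proof -
    have "take s w \<in> lists X" "w ! s \<in> X" using w that by (auto dest: in_set_takeD)
    then show ?thesis by (intro k.Units_inv_closed \<sigma>_Units) (auto simp: g_closed)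
  qed
  have last: "\<sigma> (deg w) (g j) \<in> Units k" using w j by (intro \<sigma>_Units) (auto simp: g_closed)
  have "{1..<length (w @ [j])} = insert (length w) {1..<length w}"
    using False by (auto simp: Suc_le_eq)
  then have "coeff (w @ [j]) = finprod k (?f (w @ [j])) (insert (length w) {1..<length w})"
    by (simp add: kappa_coeff_def)
  also have "\<dots> = ?f (w @ [j]) (length w) \<otimes>\<^bsub>k\<^esub> finprod k (?f (w @ [j])) {1..<length w}"
    using closed last by (intro k.finprod_insert) (auto simp: nth_append)
  also have "finprod k (?f (w @ [j])) {1..<length w} = finprod k (?f w) {1..<length w}"
    using closed by (intro k.finprod_cong') (auto simp: nth_append)
  also have "\<dots> = coeff w" using False by (simp add: kappa_coeff_def)
  also have "?f (w @ [j]) (length w) = inv\<^bsub>k\<^esub> (\<sigma> (deg w) (g j))" by simp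
  moreover have "coeff w \<in> carrier k"
    unfolding kappa_coeff_def using False closed by (auto intro!: k.finprod_closed)
  ultimately show ?thesis using last by (simp add: k.m_comm)
qed

lemma kappa_coeff_Units: "w \<in> lists X \<Longrightarrow> coeff w \<in> Units k"
proof (induction w rule: rev_induct)
  case Nil
  then show ?case by (simp add: kappa_coeff_Nil \<sigma>_Units)
next
  case (snoc j w)
  then have "w \<in> lists X" "j \<in> X" by auto
  with snoc show ?case
    by (simp add: kappa_coeff_snoc \<sigma>_Units g_closed k.Units_m_closed k.Units_inv_Units del: in_lists_conv_set)
qed

lemma kappa_coeff_closed [simp]: "w \<in> lists X \<Longrightarrow> coeff w \<in> carrier k"
  using kappa_coeff_Units k.Units_closed by blast

text \<open>The key identity. Appending a letter of degree \<open>g\<close> to \<open>v\<close> changes the left side by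
  \<open>\<sigma>(p,qg) \<sigma>(p,q)\<^sup>-\<^sup>1 \<sigma>(pq,g)\<^sup>-\<^sup>1\<close> and the right side by \<open>\<sigma>(q,g)\<^sup>-\<^sup>1\<close>, where \<open>p\<close> and \<open>q\<close> are the degrees
  of \<open>u\<close> and \<open>v\<close>; these are equal by the cocycle identity for \<open>p\<close>, \<open>q\<close>, \<open>g\<close>.\<close>
lemma kappa_coeff_append:
  assumes u: "u \<in> lists X" and v: "v \<in> lists X"
  shows "\<sigma> (deg u) (deg v) \<otimes>\<^bsub>k\<^esub> coeff (u @ v) = coeff u \<otimes>\<^bsub>k\<^esub> coeff v"
  using v
proof (induction v rule: rev_induct)
  case Nil
  then show ?case using u \<sigma>_one(2)[of "deg u"] by (simp add: kappa_coeff_Nil k.m_comm)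
next
  case (snoc j v)
  then have v: "v \<in> lists X" and j: "j \<in> X" by auto
  have uv: "u @ v \<in> lists X" using u v by simp
  have gj: "g j \<in> carrier G" using j by (rule g_closed)
  let ?s = "\<sigma> (deg u) (deg v)" and ?t = "\<sigma> (deg (u @ v)) (g j)" and ?r = "\<sigma> (deg v) (g j)"
    and ?q = "\<sigma> (deg u) (deg v \<otimes>\<^bsub>G\<^esub> g j)"
  have cl: "?s \<in> carrier k" "?q \<in> carrier k" "coeff (u @ v) \<in> carrier k" "coeff u \<in> carrier k" "coeff v \<in> carrier k"
    using u v uv gj by (simp_all del: append_in_lists_conv in_lists_conv_set)
  have un: "?t \<in> Units k" "?r \<in> Units k"
    by (rule \<sigma>_Units[OF deg_closed[OF uv] gj], rule \<sigma>_Units[OF deg_closed[OF v] gj])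
  note un' = k.Units_closed[OF un(1)] k.Units_closed[OF un(2)] k.Units_inv_closed[OF un(1)] k.Units_inv_closed[OF un(2)]
  have coc: "?s \<otimes>\<^bsub>k\<^esub> ?t = ?r \<otimes>\<^bsub>k\<^esub> ?q" using \<sigma>_cocycle[of "deg u" "deg v" "g j"] u v gj
    by (simp del: in_lists_conv_set)
  have "?q \<otimes>\<^bsub>k\<^esub> inv\<^bsub>k\<^esub> ?t = (inv\<^bsub>k\<^esub> ?r \<otimes>\<^bsub>k\<^esub> ?r) \<otimes>\<^bsub>k\<^esub> ?q \<otimes>\<^bsub>k\<^esub> inv\<^bsub>k\<^esub> ?t" using un cl un' by simp
  also have "\<dots> = inv\<^bsub>k\<^esub> ?r \<otimes>\<^bsub>k\<^esub> (?s \<otimes>\<^bsub>k\<^esub> ?t) \<otimes>\<^bsub>k\<^esub> inv\<^bsub>k\<^esub> ?t" using un' cl coc by (simp add: k.m_assoc)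
  also have "\<dots> = inv\<^bsub>k\<^esub> ?r \<otimes>\<^bsub>k\<^esub> ?s" using un un' cl by (simp add: k.m_assoc)
  finally have key: "?q \<otimes>\<^bsub>k\<^esub> inv\<^bsub>k\<^esub> ?t = inv\<^bsub>k\<^esub> ?r \<otimes>\<^bsub>k\<^esub> ?s" .
  have "\<sigma> (deg u) (deg (v @ [j])) \<otimes>\<^bsub>k\<^esub> coeff (u @ v @ [j]) = ?q \<otimes>\<^bsub>k\<^esub> (coeff (u @ v) \<otimes>\<^bsub>k\<^esub> inv\<^bsub>k\<^esub> ?t)"
    using kappa_coeff_snoc[OF uv j] v j gj by simp
  also have "\<dots> = (?q \<otimes>\<^bsub>k\<^esub> inv\<^bsub>k\<^esub> ?t) \<otimes>\<^bsub>k\<^esub> coeff (u @ v)" using un' cl by (simp add: k.m_ac)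
  also have "\<dots> = inv\<^bsub>k\<^esub> ?r \<otimes>\<^bsub>k\<^esub> (?s \<otimes>\<^bsub>k\<^esub> coeff (u @ v))" unfolding key using un' cl by (simp add: k.m_assoc)
  also have "\<dots> = inv\<^bsub>k\<^esub> ?r \<otimes>\<^bsub>k\<^esub> (coeff u \<otimes>\<^bsub>k\<^esub> coeff v)" using snoc.IH[OF v] by (simp only:)
  also have "\<dots> = coeff u \<otimes>\<^bsub>k\<^esub> coeff (v @ [j])" using kappa_coeff_snoc[OF v j] un' cl by (simp add: k.m_ac)
  finally show ?case .
qed

lemma inv_kappa_coeff_append:
  assumes u: "u \<in> lists X" and v: "v \<in> lists X"
  shows "inv\<^bsub>k\<^esub> (coeff (u @ v)) = \<sigma> (deg u) (deg v) \<otimes>\<^bsub>k\<^esub> (inv\<^bsub>k\<^esub> (coeff u) \<otimes>\<^bsub>k\<^esub> inv\<^bsub>k\<^esub> (coeff v))"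
proof (rule k.comm_inv_char)
  let ?s = "\<sigma> (deg u) (deg v)"
  have uv: "u @ v \<in> lists X" using u v by simp
  note U = kappa_coeff_Units[OF u] kappa_coeff_Units[OF v]
  have cl: "?s \<in> carrier k" "coeff (u @ v) \<in> carrier k" "coeff u \<in> carrier k" "coeff v \<in> carrier k"
    "inv\<^bsub>k\<^esub> (coeff u) \<in> carrier k" "inv\<^bsub>k\<^esub> (coeff v) \<in> carrier k"
    using u v uv U by (simp_all del: append_in_lists_conv)
  show "coeff (u @ v) \<in> carrier k" by (rule cl)
  show "?s \<otimes>\<^bsub>k\<^esub> (inv\<^bsub>k\<^esub> (coeff u) \<otimes>\<^bsub>k\<^esub> inv\<^bsub>k\<^esub> (coeff v)) \<in> carrier k" using cl by simp
  have "coeff (u @ v) \<otimes>\<^bsub>k\<^esub> (?s \<otimes>\<^bsub>k\<^esub> (inv\<^bsub>k\<^esub> (coeff u) \<otimes>\<^bsub>k\<^esub> inv\<^bsub>k\<^esub> (coeff v)))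
      = (?s \<otimes>\<^bsub>k\<^esub> coeff (u @ v)) \<otimes>\<^bsub>k\<^esub> (inv\<^bsub>k\<^esub> (coeff u) \<otimes>\<^bsub>k\<^esub> inv\<^bsub>k\<^esub> (coeff v))"
    using cl by (simp add: k.m_ac)
  also have "\<dots> = (coeff u \<otimes>\<^bsub>k\<^esub> inv\<^bsub>k\<^esub> (coeff u)) \<otimes>\<^bsub>k\<^esub> (coeff v \<otimes>\<^bsub>k\<^esub> inv\<^bsub>k\<^esub> (coeff v))"
    unfolding kappa_coeff_append[OF u v] using cl by (simp only: k.m_ac k.m_closed)
  also have "\<dots> = \<one>\<^bsub>k\<^esub>" using U by simp
  finally show "coeff (u @ v) \<otimes>\<^bsub>k\<^esub> (?s \<otimes>\<^bsub>k\<^esub> (inv\<^bsub>k\<^esub> (coeff u) \<otimes>\<^bsub>k\<^esub> inv\<^bsub>k\<^esub> (coeff v))) = \<one>\<^bsub>k\<^esub>" .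
qed

section \<open>The linear isomorphism \<open>\<kappa>\<close>\<close>

abbreviation \<kappa> where "\<kappa> \<equiv> kappa k G \<sigma> g"
definition kappa_inv where "kappa_inv = rescale (\<lambda>w. inv\<^bsub>k\<^esub> (coeff w))"

lemma kappa_rescale: "\<kappa> f = rescale coeff f"
  by (simp add: kappa_def rescale_def)

lemma inv_kappa_coeff_closed: "w \<in> lists X \<Longrightarrow> inv\<^bsub>k\<^esub> (coeff w) \<in> carrier k"
  using kappa_coeff_Units by simp

lemma kappa_closed: "f \<in> carrier F \<Longrightarrow> \<kappa> f \<in> carrier F"
  unfolding kappa_rescale by (rule rescale_closed) auto

lemma kappa_add: "f \<in> carrier F \<Longrightarrow> f' \<in> carrier F \<Longrightarrow> \<kappa> (f \<oplus>\<^bsub>F\<^esub> f') = \<kappa> f \<oplus>\<^bsub>F\<^esub> \<kappa> f'"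
  unfolding kappa_rescale by (rule rescale_add) auto

lemma kappa_smult: "c \<in> carrier k \<Longrightarrow> f \<in> carrier F \<Longrightarrow> \<kappa> (c \<odot>\<^bsub>F\<^esub> f) = c \<odot>\<^bsub>F\<^esub> \<kappa> f"
  unfolding kappa_rescale by (rule rescale_smult) auto

lemma kappa_zero: "\<kappa> \<zero>\<^bsub>F\<^esub> = \<zero>\<^bsub>F\<^esub>"
  by (simp add: kappa_def)

lemma kappa_monomial: "c \<in> carrier k \<Longrightarrow> w \<in> lists X \<Longrightarrow> \<kappa> (monomial k c w) = monomial k (coeff w \<otimes>\<^bsub>k\<^esub> c) w"
  unfolding kappa_rescale by (rule rescale_monomial) auto

lemma kappa_inv_closed: "f \<in> carrier F \<Longrightarrow> kappa_inv f \<in> carrier F"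
  unfolding kappa_inv_def by (rule rescale_closed) (auto intro: inv_kappa_coeff_closed)

lemma kappa_inv_add: "f \<in> carrier F \<Longrightarrow> f' \<in> carrier F \<Longrightarrow> kappa_inv (f \<oplus>\<^bsub>F\<^esub> f') = kappa_inv f \<oplus>\<^bsub>F\<^esub> kappa_inv f'"
  unfolding kappa_inv_def by (rule rescale_add) (auto intro: inv_kappa_coeff_closed)

lemma kappa_inv_smult: "c \<in> carrier k \<Longrightarrow> f \<in> carrier F \<Longrightarrow> kappa_inv (c \<odot>\<^bsub>F\<^esub> f) = c \<odot>\<^bsub>F\<^esub> kappa_inv f"
  unfolding kappa_inv_def by (rule rescale_smult) (auto intro: inv_kappa_coeff_closed)

lemma kappa_inv_monomial:
  "c \<in> carrier k \<Longrightarrow> w \<in> lists X \<Longrightarrow> kappa_inv (monomial k c w) = monomial k (inv\<^bsub>k\<^esub> (coeff w) \<otimes>\<^bsub>k\<^esub> c) w"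
  unfolding kappa_inv_def by (rule rescale_monomial) (auto intro: inv_kappa_coeff_closed)

lemma kappa_kappa_inv: "f \<in> carrier F \<Longrightarrow> \<kappa> (kappa_inv f) = f"
  unfolding kappa_inv_def kappa_rescale
  by (rule rescale_inverse) (auto intro: inv_kappa_coeff_closed kappa_coeff_Units k.Units_r_inv)

lemma kappa_inv_kappa: "f \<in> carrier F \<Longrightarrow> kappa_inv (\<kappa> f) = f"
  unfolding kappa_inv_def kappa_rescale
  by (rule rescale_inverse) (auto intro: inv_kappa_coeff_closed kappa_coeff_Units k.Units_l_inv)

text \<open>By bilinearity this is \<open>kappa_coeff_append\<close>: up to the scalar \<open>\<sigma>(p,q)\<close>, the map \<open>\<kappa>\<close> is
  multiplicative on homogeneous elements.\<close>
lemma kappa_mult_homogeneous: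
  assumes a: "a \<in> carrier F" "{w. a w \<noteq> \<zero>\<^bsub>k\<^esub>} \<subseteq> {w. deg w = p}"
    and b: "b \<in> carrier F" "{w. b w \<noteq> \<zero>\<^bsub>k\<^esub>} \<subseteq> {w. deg w = q}"
    and p: "p \<in> carrier G" and q: "q \<in> carrier G"
  shows "\<sigma> p q \<odot>\<^bsub>F\<^esub> \<kappa> (a \<otimes>\<^bsub>F\<^esub> b) = \<kappa> a \<otimes>\<^bsub>F\<^esub> \<kappa> b"
proof -
  \<comment> \<open>\<open>in_lists_conv_set\<close> would destroy the form \<open>w \<in> lists X\<close> in which the facts on degrees are stated.\<close>
  note [simp del] = F_simps in_lists_conv_set
  note [simp] = p q kappa_zero kappa_add kappa_closed F.smult_r_distr F.l_distr F.r_distr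
  have mon: "\<sigma> p q \<odot>\<^bsub>F\<^esub> \<kappa> (monomial k c u \<otimes>\<^bsub>F\<^esub> b) = \<kappa> (monomial k c u) \<otimes>\<^bsub>F\<^esub> \<kappa> b"
    if c: "c \<in> carrier k" and u: "u \<in> lists X" "u \<in> {w. deg w = p}" for c u
    using b
  proof (induction b rule: monomial_induct_on)
    case (monomial d v)
    have "\<sigma> p q \<otimes>\<^bsub>k\<^esub> (coeff (u @ v) \<otimes>\<^bsub>k\<^esub> (c \<otimes>\<^bsub>k\<^esub> d))
        = (\<sigma> p q \<otimes>\<^bsub>k\<^esub> coeff (u @ v)) \<otimes>\<^bsub>k\<^esub> (c \<otimes>\<^bsub>k\<^esub> d)"
      using monomial c u by (simp add: k.m_assoc)
    also have "\<dots> = (coeff u \<otimes>\<^bsub>k\<^esub> coeff v) \<otimes>\<^bsub>k\<^esub> (c \<otimes>\<^bsub>k\<^esub> d)"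
      using kappa_coeff_append[of u v] monomial u by simp
    also have "\<dots> = (coeff u \<otimes>\<^bsub>k\<^esub> c) \<otimes>\<^bsub>k\<^esub> (coeff v \<otimes>\<^bsub>k\<^esub> d)"
      using monomial c u by (simp add: k.m_ac)
    finally show ?case
      using monomial c u by (simp add: mult_monomial kappa_monomial smult_monomial)
  qed (use c u in simp_all)
  show ?thesis
    using a by (induction a rule: monomial_induct_on) (use b(1) mon in simp_all)
qed

section \<open>Homogeneous components in the free algebra\<close>

text \<open>The sum of the homogeneous components with degrees in \<open>S\<close>; a whole set of degrees is allowed so
  that an element can be rebuilt from its components by induction on \<open>S\<close>.\<close>
definition part where "part S f = (\<lambda>w. if deg w \<in> S then f w else \<zero>\<^bsub>k\<^esub>)"

lemma part_closed [simp]: "f \<in> carrier F \<Longrightarrow> part S f \<in> carrier F"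
  by (rule carrier_F_supportI[of "{w. f w \<noteq> \<zero>\<^bsub>k\<^esub>}"])
    (auto simp: part_def support_F split: if_splits)

lemma part_zero: "part S \<zero>\<^bsub>F\<^esub> = \<zero>\<^bsub>F\<^esub>"
  by (simp add: part_def)

lemma part_add: "f \<in> carrier F \<Longrightarrow> f' \<in> carrier F \<Longrightarrow> part S (f \<oplus>\<^bsub>F\<^esub> f') = part S f \<oplus>\<^bsub>F\<^esub> part S f'"
  by (auto simp: part_def fun_eq_iff)

lemma part_smult: "c \<in> carrier k \<Longrightarrow> f \<in> carrier F \<Longrightarrow> part S (c \<odot>\<^bsub>F\<^esub> f) = c \<odot>\<^bsub>F\<^esub> part S f"
  by (auto simp: part_def fun_eq_iff)

lemma part_monomial: "part S (monomial k c w) = (if deg w \<in> S then monomial k c w else \<zero>\<^bsub>F\<^esub>)"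
  by (auto simp: part_def monomial_def fun_eq_iff)

lemma part_support: "{w. part {h} f w \<noteq> \<zero>\<^bsub>k\<^esub>} \<subseteq> {w. deg w = h}"
  by (auto simp: part_def split: if_splits)

lemma part_insert: "f \<in> carrier F \<Longrightarrow> h \<notin> S \<Longrightarrow> part (insert h S) f = part {h} f \<oplus>\<^bsub>F\<^esub> part S f"
  by (auto simp: part_def fun_eq_iff)

text \<open>A word has only one degree, so in a sum of homogeneous elements its coefficient comes from the
  summand of that degree. This gives existence and uniqueness of the decomposition at once.\<close>
lemma homogeneous_decomp_F:
  assumes f: "f \<in> carrier F"
  shows "homogeneous_decomp G F (free_grading k G X g) f c \<longleftrightarrow>
    c = (\<lambda>h. if h \<in> carrier G then part {h} f else \<zero>\<^bsub>F\<^esub>)" (is "?L \<longleftrightarrow> c = ?c")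
proof
  have fg: "free_grading k G X g h = {f \<in> carrier F. \<forall>w. f w \<noteq> \<zero>\<^bsub>k\<^esub> \<longrightarrow> deg w = h}" for h
    unfolding free_grading_def F_def[symmetric] by (rule refl)
  have pointwise: "finsum F d S w = d (deg w) w"
    if d: "\<And>h. d h \<in> carrier F" "\<And>h w. d h w \<noteq> \<zero>\<^bsub>k\<^esub> \<Longrightarrow> deg w = h"
      and S: "finite S" "\<And>h. d h \<noteq> \<zero>\<^bsub>F\<^esub> \<Longrightarrow> h \<in> S" for d S w
  proof -
    have "finsum F d S w = (\<Oplus>\<^bsub>k\<^esub>h\<in>S. d h w)" using S(1) d(1) by (rule finsum_F_apply)
    also have "\<dots> = (\<Oplus>\<^bsub>k\<^esub>h\<in>S. if deg w = h then d h w else \<zero>\<^bsub>k\<^esub>)"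
      using d by (intro k.finsum_cong') (auto simp del: F_simps)
    also have "\<dots> = d (deg w) w"
    proof (cases "deg w \<in> S")
      case True
      then show ?thesis
        using k.finsum_singleton[of "deg w" S "\<lambda>h. d h w"] S d(1) by simp
    next
      case False
      then have "d (deg w) = \<zero>\<^bsub>F\<^esub>" using S(2) by blast
      moreover have "(\<Oplus>\<^bsub>k\<^esub>h\<in>S. if deg w = h then d h w else \<zero>\<^bsub>k\<^esub>) = \<zero>\<^bsub>k\<^esub>"
        using False by (intro k.add.finprod_one_eqI) auto
      ultimately show ?thesis by simp
    qed
    finally show ?thesis .
  qed
  {
    assume L: ?L
    have cF: "c h \<in> carrier F" for h
      using L F.zero_closed unfolding homogeneous_decomp_def fg by (cases "h \<in> carrier G") auto
    have cw: "deg w = h" if "c h w \<noteq> \<zero>\<^bsub>k\<^esub>" for h w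
      using L that unfolding homogeneous_decomp_def fg by (cases "h \<in> carrier G") auto
    have sum: "f = finsum F c {h. c h \<noteq> \<zero>\<^bsub>F\<^esub>}" and fin: "finite {h. c h \<noteq> \<zero>\<^bsub>F\<^esub>}"
      using L unfolding homogeneous_decomp_def by blast+
    have fw: "f w = c (deg w) w" for w
      by (subst sum, rule pointwise) (use cF cw fin in auto)
    have "c h w = ?c h w" for h w
    proof (cases "h \<in> carrier G")
      case True
      then show ?thesis using fw[of w] cw[of h w] by (auto simp: part_def)
    next
      case False
      then show ?thesis using L unfolding homogeneous_decomp_def by simp
    qed
    then show "c = ?c" by (intro ext)
  }
  {
    assume c: "c = ?c"
    have cw: "deg w = h" if "c h w \<noteq> \<zero>\<^bsub>k\<^esub>" for h w
      using that c by (auto simp: part_def split: if_splits)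
    have c0: "c h = \<zero>\<^bsub>F\<^esub>" if "h \<notin> carrier G" for h using that c by simp
    have cF: "c h \<in> carrier F" for h using c f F.zero_closed by simp
    have fin: "finite {h. c h \<noteq> \<zero>\<^bsub>F\<^esub>}"
    proof (rule finite_subset)
      show "{h. c h \<noteq> \<zero>\<^bsub>F\<^esub>} \<subseteq> deg ` {w. f w \<noteq> \<zero>\<^bsub>k\<^esub>}"
        using c by (auto simp: part_def fun_eq_iff split: if_splits)
      show "finite (deg ` {w. f w \<noteq> \<zero>\<^bsub>k\<^esub>})" using support_F[OF f] by simp
    qed
    have "f w = c (deg w) w" for w
    proof (cases "w \<in> lists X")
      case True
      then show ?thesis using c by (simp add: part_def)
    next
      case False
      then show ?thesis using c coeff_outside[OF f] by (simp add: part_def)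
    qed
    moreover have "finsum F c {h. c h \<noteq> \<zero>\<^bsub>F\<^esub>} w = c (deg w) w" for w
      by (rule pointwise) (use cF cw fin in auto)
    ultimately have "f = finsum F c {h. c h \<noteq> \<zero>\<^bsub>F\<^esub>}" by (intro ext) simp
    then show ?L
      unfolding homogeneous_decomp_def fg using cF cw c0 fin by blast
  }
qed

lemma component_F:
  assumes "f \<in> carrier F" "h \<in> carrier G"
  shows "component G F (free_grading k G X g) f h = part {h} f"
  unfolding component_def homogeneous_decomp_F[OF assms(1)] using assms(2) by simp

text \<open>Multiplication by a word of degree \<open>p\<close> shifts degrees: on the left, the component of degree
  \<open>h\<close> comes from the one of degree \<open>p\<^sup>-\<^sup>1h\<close>; on the right, from the one of degree \<open>hp\<^sup>-\<^sup>1\<close>.\<close>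
lemma part_monomial_mult:
  assumes f: "f \<in> carrier F" and c: "c \<in> carrier k" and u: "u \<in> lists X" and h: "h \<in> carrier G"
  shows "part {h} (monomial k c u \<otimes>\<^bsub>F\<^esub> f) = monomial k c u \<otimes>\<^bsub>F\<^esub> part {inv\<^bsub>G\<^esub> (deg u) \<otimes>\<^bsub>G\<^esub> h} f"
    and "part {h} (f \<otimes>\<^bsub>F\<^esub> monomial k c u) = part {h \<otimes>\<^bsub>G\<^esub> inv\<^bsub>G\<^esub> (deg u)} f \<otimes>\<^bsub>F\<^esub> monomial k c u"
proof -
  note [simp del] = F_simps in_lists_conv_set
  note [simp] = part_zero part_add part_monomial F.l_distr F.r_distr mult_monomial c u h
  show "part {h} (monomial k c u \<otimes>\<^bsub>F\<^esub> f) = monomial k c u \<otimes>\<^bsub>F\<^esub> part {inv\<^bsub>G\<^esub> (deg u) \<otimes>\<^bsub>G\<^esub> h} f"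
    using f
  proof (induction f rule: monomial_induct)
    case (monomial d v)
    then show ?case using G.inv_solve_left[of "deg v" "deg u" h] by auto
  qed simp_all
  show "part {h} (f \<otimes>\<^bsub>F\<^esub> monomial k c u) = part {h \<otimes>\<^bsub>G\<^esub> inv\<^bsub>G\<^esub> (deg u)} f \<otimes>\<^bsub>F\<^esub> monomial k c u"
    using f
  proof (induction f rule: monomial_induct)
    case (monomial d v)
    then show ?case using G.inv_solve_right[of "deg v" h "deg u"] by auto
  qed simp_all
qed

section \<open>Two-sided ideals under \<open>\<kappa>\<close>\<close>

text \<open>Closure under multiplication is additive in the factor, so a monomial may be taken. By
  \<open>part_monomial_mult\<close> each component of the product is then a product of homogeneous elements, and
  \<open>kappa_mult_homogeneous\<close> turns \<open>\<kappa>\<close> of it into a unit times a multiple of an element of \<open>J\<close>.\<close>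
lemma ideal_kappa_parts:
  assumes J: "ideal J F"
  shows "ideal {f \<in> carrier F. \<forall>h\<in>carrier G. \<kappa> (part {h} f) \<in> J} F" (is "ideal ?I F")
proof -
  note [simp del] = F_simps in_lists_conv_set
  interpret J: ideal J F by (rule J)
  have I_zero: "\<zero>\<^bsub>F\<^esub> \<in> ?I" by (simp add: part_zero kappa_zero)
  have I_add: "a \<oplus>\<^bsub>F\<^esub> b \<in> ?I" if "a \<in> ?I" "b \<in> ?I" for a b
    using that by (auto simp: part_add kappa_add intro: J.a_closed)
  have smult: "c \<odot>\<^bsub>F\<^esub> a \<in> ?I" if "c \<in> carrier k" "a \<in> ?I" for c a
    using that by (auto simp: part_smult kappa_smult intro: F.ideal_smult_closed[OF J])
  have "submodule ?I k F"
  proof (rule F.submoduleI)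
    show "\<ominus>\<^bsub>F\<^esub> a \<in> ?I" if a: "a \<in> ?I" for a
      using smult[of "\<ominus>\<^bsub>k\<^esub> \<one>\<^bsub>k\<^esub>" a] a F.smult_l_minus[of "\<one>\<^bsub>k\<^esub>" a] by simp
  qed (use I_zero I_add smult in blast)+
  then have sub: "subgroup ?I (add_monoid F)" by (rule submodule.axioms)
  have unit: "inv\<^bsub>k\<^esub> (\<sigma> p q) \<odot>\<^bsub>F\<^esub> (\<sigma> p q \<odot>\<^bsub>F\<^esub> a) = a"
    if "p \<in> carrier G" "q \<in> carrier G" "a \<in> carrier F" for p q a
    using that \<sigma>_Units[of p q] by (simp add: F.smult_assoc1[symmetric])
  have kappa_mult_J: "\<kappa> (a \<otimes>\<^bsub>F\<^esub> b) \<in> J"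
    if a: "a \<in> carrier F" "{w. a w \<noteq> \<zero>\<^bsub>k\<^esub>} \<subseteq> {w. deg w = p}"
      and b: "b \<in> carrier F" "{w. b w \<noteq> \<zero>\<^bsub>k\<^esub>} \<subseteq> {w. deg w = q}"
      and pq: "p \<in> carrier G" "q \<in> carrier G" and J': "\<kappa> a \<otimes>\<^bsub>F\<^esub> \<kappa> b \<in> J" for a b p q
  proof -
    have "\<kappa> (a \<otimes>\<^bsub>F\<^esub> b) = inv\<^bsub>k\<^esub> (\<sigma> p q) \<odot>\<^bsub>F\<^esub> (\<sigma> p q \<odot>\<^bsub>F\<^esub> \<kappa> (a \<otimes>\<^bsub>F\<^esub> b))"
      using pq kappa_closed[OF F.m_closed[OF a(1) b(1)]] by (rule unit[symmetric])
    also have "\<dots> = inv\<^bsub>k\<^esub> (\<sigma> p q) \<odot>\<^bsub>F\<^esub> (\<kappa> a \<otimes>\<^bsub>F\<^esub> \<kappa> b)"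
      by (simp only: kappa_mult_homogeneous[OF a b pq])
    finally show ?thesis using F.ideal_smult_closed[OF J _ J'] \<sigma>_Units[OF pq] by simp
  qed
  have mon: "monomial k c u \<otimes>\<^bsub>F\<^esub> f \<in> ?I" "f \<otimes>\<^bsub>F\<^esub> monomial k c u \<in> ?I"
    if c: "c \<in> carrier k" and u: "u \<in> lists X" and f: "f \<in> ?I" for c u f
  proof -
    have fF: "f \<in> carrier F" using f by simp
    have supp_u: "{w. monomial k c u w \<noteq> \<zero>\<^bsub>k\<^esub>} \<subseteq> {w. deg w = deg u}"
      by (auto simp: monomial_def split: if_splits)
    have m: "monomial k c u \<in> carrier F" using c u by simp
    have "\<kappa> (part {h} (monomial k c u \<otimes>\<^bsub>F\<^esub> f)) \<in> J" if h: "h \<in> carrier G" for h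
      unfolding part_monomial_mult(1)[OF fF c u h]
    proof (rule kappa_mult_J[OF m supp_u part_closed[OF fF] part_support])
      let ?h = "inv\<^bsub>G\<^esub> (deg u) \<otimes>\<^bsub>G\<^esub> h"
      show "deg u \<in> carrier G" "?h \<in> carrier G" using u h by simp_all
      then show "\<kappa> (monomial k c u) \<otimes>\<^bsub>F\<^esub> \<kappa> (part {?h} f) \<in> J"
        using f kappa_closed[OF m] by (intro J.I_l_closed) auto
    qed
    then show "monomial k c u \<otimes>\<^bsub>F\<^esub> f \<in> ?I" using m fF by simp
    have "\<kappa> (part {h} (f \<otimes>\<^bsub>F\<^esub> monomial k c u)) \<in> J" if h: "h \<in> carrier G" for h
      unfolding part_monomial_mult(2)[OF fF c u h]
    proof (rule kappa_mult_J[OF part_closed[OF fF] part_support m supp_u])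
      let ?h = "h \<otimes>\<^bsub>G\<^esub> inv\<^bsub>G\<^esub> (deg u)"
      show "deg u \<in> carrier G" "?h \<in> carrier G" using u h by simp_all
      then show "\<kappa> (part {?h} f) \<otimes>\<^bsub>F\<^esub> \<kappa> (monomial k c u) \<in> J"
        using f kappa_closed[OF m] by (intro J.I_r_closed) auto
    qed
    then show "f \<otimes>\<^bsub>F\<^esub> monomial k c u \<in> ?I" using m fF by simp
  qed
  have I_F: "f \<in> carrier F" if "f \<in> ?I" for f using that by simp
  show ?thesis
  proof (rule idealI[OF F.ring_axioms sub])
    show "a \<otimes>\<^bsub>F\<^esub> f \<in> ?I" if f: "f \<in> ?I" and a: "a \<in> carrier F" for f a
      using a
    proof (induction a rule: monomial_induct)
      case zero
      then show ?case using I_zero I_F[OF f] by simp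
    next
      case (monomial c w)
      then show ?case using f by (intro mon)
    next
      case (add a b)
      then show ?case using I_add[OF add.IH] I_F[OF f] F.l_distr[of a b f] by (simp only:)
    qed
    show "f \<otimes>\<^bsub>F\<^esub> a \<in> ?I" if f: "f \<in> ?I" and a: "a \<in> carrier F" for f a
      using a
    proof (induction a rule: monomial_induct)
      case zero
      then show ?case using I_zero I_F[OF f] by simp
    next
      case (monomial c w)
      then show ?case using f by (intro mon)
    next
      case (add a b)
      then show ?case using I_add[OF add.IH] I_F[OF f] F.r_distr[of a b f] by (simp only:)
    qed
  qed
qed

lemma kappa_mem_if_parts:
  assumes J: "ideal J F" and f: "f \<in> carrier F" and parts: "\<And>h. h \<in> carrier G \<Longrightarrow> \<kappa> (part {h} f) \<in> J"
  shows "\<kappa> f \<in> J"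
proof -
  note [simp del] = F_simps in_lists_conv_set
  interpret J: ideal J F by (rule J)
  have "\<kappa> (part S f) \<in> J" if "finite S" "S \<subseteq> carrier G" for S
    using that
  proof (induction S)
    case empty
    have "part {} f = \<zero>\<^bsub>F\<^esub>" by (simp add: part_def F_simps)
    then show ?case by (simp add: kappa_zero)
  next
    case (insert h S)
    then have "\<kappa> (part S f) \<in> J" "\<kappa> (part {h} f) \<in> J" using parts[of h] by simp_all
    then show ?case
      unfolding part_insert[OF f insert.hyps(2)] kappa_add[OF part_closed[OF f] part_closed[OF f]]
      by (intro J.a_closed)
  qed
  moreover have "deg ` {w. f w \<noteq> \<zero>\<^bsub>k\<^esub>} \<subseteq> carrier G"
    using support_F[OF f] deg_closed by blast
  ultimately have "\<kappa> (part (deg ` {w. f w \<noteq> \<zero>\<^bsub>k\<^esub>}) f) \<in> J" using support_F[OF f] by simp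
  moreover have "part (deg ` {w. f w \<noteq> \<zero>\<^bsub>k\<^esub>}) f = f" by (auto simp: part_def fun_eq_iff)
  ultimately show ?thesis by simp
qed

text \<open>The preimage \<open>?N\<close> of \<open>J\<close> under \<open>\<kappa>\<close> is a submodule containing \<open>P\<close>, hence contains the span of
  \<open>P\<close>, and with it the components of every relation. So \<open>P\<close> lies in the ideal of
  \<open>ideal_kappa_parts\<close>.\<close>
lemma kappa_genideal:
  assumes P: "P \<subseteq> carrier F"
    and graded: "graded_submodule k G F (free_grading k G X g) (module_span k F P)"
    and f: "f \<in> Idl\<^bsub>F\<^esub> P"
  shows "\<kappa> f \<in> Idl\<^bsub>F\<^esub> (\<kappa> ` P)"
proof -
  note [simp del] = F_simps in_lists_conv_set
  let ?J = "Idl\<^bsub>F\<^esub> (\<kappa> ` P)"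
  have KP: "\<kappa> ` P \<subseteq> carrier F" using P kappa_closed by blast
  have J: "ideal ?J F" using KP by (rule F.genideal_ideal)
  interpret J: ideal ?J F by (rule J)
  let ?N = "{f \<in> carrier F. \<kappa> f \<in> ?J}"
  have smult: "c \<odot>\<^bsub>F\<^esub> a \<in> ?N" if "c \<in> carrier k" "a \<in> ?N" for c a
    using that by (auto simp: kappa_smult intro: F.ideal_smult_closed[OF J])
  have "submodule ?N k F"
  proof (rule F.submoduleI)
    show "\<ominus>\<^bsub>F\<^esub> a \<in> ?N" if a: "a \<in> ?N" for a
      using smult[of "\<ominus>\<^bsub>k\<^esub> \<one>\<^bsub>k\<^esub>" a] a F.smult_l_minus[of "\<one>\<^bsub>k\<^esub>" a] by simp
  qed (use smult in \<open>auto simp: kappa_zero kappa_add intro: J.a_closed\<close>)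
  moreover have "P \<subseteq> ?N" using P F.genideal_self[OF KP] by blast
  ultimately have span: "module_span k F P \<subseteq> ?N" unfolding module_span_def by blast
  let ?I = "{f \<in> carrier F. \<forall>h\<in>carrier G. \<kappa> (part {h} f) \<in> ?J}"
  have "P \<subseteq> ?I"
  proof
    fix a assume a: "a \<in> P"
    then have aF: "a \<in> carrier F" using P by blast
    have "a \<in> module_span k F P" using a unfolding module_span_def by blast
    then have mem: "component G F (free_grading k G X g) a h \<in> module_span k F P" if "h \<in> carrier G" for h
      using graded that unfolding graded_submodule_def by blast
    have "\<kappa> (part {h} a) \<in> ?J" if "h \<in> carrier G" for h
      using span mem[OF that] unfolding component_F[OF aF that] by blast
    then show "a \<in> ?I" using aF by blast
  qed
  then have "Idl\<^bsub>F\<^esub> P \<subseteq> ?I" using ideal_kappa_parts[OF J] by (intro F.genideal_minimal)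
  then show ?thesis using f kappa_mem_if_parts[OF J] by blast
qed

section \<open>The presentation of the twisted algebra\<close>

lemma smult_mult_smult:
  assumes "c \<in> carrier k" "a \<in> carrier A" "d \<in> carrier k" "b \<in> carrier A"
  shows "(c \<odot>\<^bsub>A\<^esub> a) \<otimes>\<^bsub>A\<^esub> (d \<odot>\<^bsub>A\<^esub> b) = (c \<otimes>\<^bsub>k\<^esub> d) \<odot>\<^bsub>A\<^esub> (a \<otimes>\<^bsub>A\<^esub> b)"
  unfolding A.smult_assoc_left[OF assms(1,2) A.smult_closed[OF assms(3,4)]]
    A.smult_assoc_right[OF assms(3,2,4)] A.smult_assoc1[OF assms(1,3) A.m_closed[OF assms(2,4)]]
  by (rule refl)

text \<open>On monomials with words \<open>u\<close>, \<open>v\<close> the factor \<open>\<sigma>(p,q)\<close> of the twisted product is exactly the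
  discrepancy between \<open>\<kappa>\<^sub>u\<^sub>v\<^sup>-\<^sup>1\<close> and \<open>\<kappa>\<^sub>u\<^sup>-\<^sup>1 \<kappa>\<^sub>v\<^sup>-\<^sup>1\<close>. The unit is preserved because \<open>\<kappa>\<close> sends \<open>1\<close> to
  \<open>\<sigma>(1,1)\<close>.\<close>
lemma hom_twist:
  assumes hom: "\<pi> \<in> ring_hom F A"
    and lin: "\<And>c f. c \<in> carrier k \<Longrightarrow> f \<in> carrier F \<Longrightarrow> \<pi> (c \<odot>\<^bsub>F\<^esub> f) = c \<odot>\<^bsub>A\<^esub> \<pi> f"
    and gen: "\<And>j. j \<in> X \<Longrightarrow> \<pi> (monomial k \<one>\<^bsub>k\<^esub> [j]) \<in> D (g j)"
  shows "(\<lambda>f. \<pi> (kappa_inv f)) \<in> ring_hom F T"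
proof -
  note [simp del] = F_simps in_lists_conv_set
  note [simp] = inv_kappa_coeff_closed kappa_inv_closed kappa_inv_add
  have \<pi>_closed [simp]: "\<pi> f \<in> carrier A" if "f \<in> carrier F" for f
    using hom that by (rule ring_hom_closed)
  have \<pi>_mult: "\<pi> (a \<otimes>\<^bsub>F\<^esub> b) = \<pi> a \<otimes>\<^bsub>A\<^esub> \<pi> b" if "a \<in> carrier F" "b \<in> carrier F" for a b
    using hom that by (rule ring_hom_mult)
  have \<pi>_add: "\<pi> (a \<oplus>\<^bsub>F\<^esub> b) = \<pi> a \<oplus>\<^bsub>A\<^esub> \<pi> b" if "a \<in> carrier F" "b \<in> carrier F" for a b
    using hom that by (rule ring_hom_add)
  have \<pi>_one: "\<pi> (monomial k \<one>\<^bsub>k\<^esub> []) = \<one>\<^bsub>A\<^esub>"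
    using ring_hom_one[OF hom] by (simp add: F_simps(4))
  have \<pi>_zero: "\<pi> \<zero>\<^bsub>F\<^esub> = \<zero>\<^bsub>A\<^esub>"
    using lin[OF k.zero_closed F.zero_closed] by simp
  have word_D: "\<pi> (monomial k \<one>\<^bsub>k\<^esub> w) \<in> D (deg w)" if "w \<in> lists X" for w
    using that
  proof (induction w)
    case Nil
    then show ?case using graded.one_degree \<pi>_one by simp
  next
    case (Cons j w)
    then have j: "j \<in> X" and w: "w \<in> lists X" by auto
    have "[j] \<in> lists X" using j by simp
    then have "\<pi> (monomial k \<one>\<^bsub>k\<^esub> (j # w)) = \<pi> (monomial k \<one>\<^bsub>k\<^esub> [j]) \<otimes>\<^bsub>A\<^esub> \<pi> (monomial k \<one>\<^bsub>k\<^esub> w)"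
      using \<pi>_mult[of "monomial k \<one>\<^bsub>k\<^esub> [j]" "monomial k \<one>\<^bsub>k\<^esub> w"] w by (simp add: mult_monomial)
    then show ?case
      using graded.mult_degree[OF g_closed[OF j] deg_closed[OF w] gen[OF j] Cons.IH] by simp
  qed
  let ?\<pi> = "\<lambda>f. \<pi> (kappa_inv f)"
  have monomial_value: "?\<pi> (monomial k c w) = (inv\<^bsub>k\<^esub> (coeff w) \<otimes>\<^bsub>k\<^esub> c) \<odot>\<^bsub>A\<^esub> \<pi> (monomial k \<one>\<^bsub>k\<^esub> w)"
    if "c \<in> carrier k" "w \<in> lists X" for c w
    using that lin[of "inv\<^bsub>k\<^esub> (coeff w) \<otimes>\<^bsub>k\<^esub> c" "monomial k \<one>\<^bsub>k\<^esub> w"]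
    by (simp add: kappa_inv_monomial smult_monomial)
  have add: "?\<pi> (a \<oplus>\<^bsub>F\<^esub> b) = ?\<pi> a \<oplus>\<^bsub>A\<^esub> ?\<pi> b" if "a \<in> carrier F" "b \<in> carrier F" for a b
    using that by (simp add: \<pi>_add)
  have zero: "?\<pi> \<zero>\<^bsub>F\<^esub> = \<zero>\<^bsub>A\<^esub>"
    using \<pi>_zero by (simp add: kappa_inv_def rescale_def F_simps)
  have mult_mon: "?\<pi> (monomial k c u \<otimes>\<^bsub>F\<^esub> monomial k d v) = ?\<pi> (monomial k c u) \<otimes>\<^bsub>T\<^esub> ?\<pi> (monomial k d v)"
    if c: "c \<in> carrier k" "d \<in> carrier k" and u: "u \<in> lists X" and v: "v \<in> lists X" for c d u v
  proof -
    let ?e = "\<lambda>w. \<pi> (monomial k \<one>\<^bsub>k\<^esub> w)"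
    let ?iu = "inv\<^bsub>k\<^esub> (coeff u)" and ?iv = "inv\<^bsub>k\<^esub> (coeff v)" and ?s = "\<sigma> (deg u) (deg v)"
    have cl: "?iu \<in> carrier k" "?iv \<in> carrier k" "?s \<in> carrier k" "?e u \<in> carrier A" "?e v \<in> carrier A"
      using u v by simp_all
    have e: "?e (u @ v) = ?e u \<otimes>\<^bsub>A\<^esub> ?e v"
      using \<pi>_mult[of "monomial k \<one>\<^bsub>k\<^esub> u" "monomial k \<one>\<^bsub>k\<^esub> v"] u v by (simp add: mult_monomial)
    have "?\<pi> (monomial k c u \<otimes>\<^bsub>F\<^esub> monomial k d v) = (?s \<otimes>\<^bsub>k\<^esub> (?iu \<otimes>\<^bsub>k\<^esub> ?iv) \<otimes>\<^bsub>k\<^esub> (c \<otimes>\<^bsub>k\<^esub> d)) \<odot>\<^bsub>A\<^esub> (?e u \<otimes>\<^bsub>A\<^esub> ?e v)"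
      using c u v by (simp add: mult_monomial monomial_value inv_kappa_coeff_append e)
    also have "?s \<otimes>\<^bsub>k\<^esub> (?iu \<otimes>\<^bsub>k\<^esub> ?iv) \<otimes>\<^bsub>k\<^esub> (c \<otimes>\<^bsub>k\<^esub> d) = ?s \<otimes>\<^bsub>k\<^esub> ((?iu \<otimes>\<^bsub>k\<^esub> c) \<otimes>\<^bsub>k\<^esub> (?iv \<otimes>\<^bsub>k\<^esub> d))"
      using c cl by (simp add: k.m_ac)
    also have "\<dots> \<odot>\<^bsub>A\<^esub> (?e u \<otimes>\<^bsub>A\<^esub> ?e v)
        = ?s \<odot>\<^bsub>A\<^esub> (((?iu \<otimes>\<^bsub>k\<^esub> c) \<odot>\<^bsub>A\<^esub> ?e u) \<otimes>\<^bsub>A\<^esub> ((?iv \<otimes>\<^bsub>k\<^esub> d) \<odot>\<^bsub>A\<^esub> ?e v))"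
      using c cl smult_mult_smult[of "?iu \<otimes>\<^bsub>k\<^esub> c" "?e u" "?iv \<otimes>\<^bsub>k\<^esub> d" "?e v"] by (simp add: A.smult_assoc1)
    also have "\<dots> = ((?iu \<otimes>\<^bsub>k\<^esub> c) \<odot>\<^bsub>A\<^esub> ?e u) \<otimes>\<^bsub>T\<^esub> ((?iv \<otimes>\<^bsub>k\<^esub> d) \<odot>\<^bsub>A\<^esub> ?e v)"
      using c cl u v by (intro T_mult_homogeneous[symmetric] D_smult word_D) simp_all
    also have "\<dots> = ?\<pi> (monomial k c u) \<otimes>\<^bsub>T\<^esub> ?\<pi> (monomial k d v)"
      using c u v by (simp only: monomial_value)
    finally show ?thesis .
  qed
  have mult_mon': "?\<pi> (monomial k c u \<otimes>\<^bsub>F\<^esub> b) = ?\<pi> (monomial k c u) \<otimes>\<^bsub>T\<^esub> ?\<pi> b"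
    if c: "c \<in> carrier k" and u: "u \<in> lists X" and b: "b \<in> carrier F" for c u b
    using b by (induction b rule: monomial_induct)
      (use c u mult_mon in \<open>simp_all add: zero add F.r_distr T_mult_zero T_mult_add del: kappa_inv_add\<close>)
  show ?thesis
  proof (rule ring_hom_memI)
    show "?\<pi> f \<in> carrier T" if "f \<in> carrier F" for f using that by simp
    show "?\<pi> (a \<otimes>\<^bsub>F\<^esub> b) = ?\<pi> a \<otimes>\<^bsub>T\<^esub> ?\<pi> b" if a: "a \<in> carrier F" and b: "b \<in> carrier F" for a b
      using a by (induction a rule: monomial_induct)
        (use b mult_mon' in \<open>simp_all add: zero add F.l_distr T_mult_zero T_mult_add del: kappa_inv_add\<close>)
    show "?\<pi> (a \<oplus>\<^bsub>F\<^esub> b) = ?\<pi> a \<oplus>\<^bsub>T\<^esub> ?\<pi> b" if "a \<in> carrier F" "b \<in> carrier F" for a b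
      using add that by simp
    show "?\<pi> \<one>\<^bsub>F\<^esub> = \<one>\<^bsub>T\<^esub>"
      using monomial_value[of "\<one>\<^bsub>k\<^esub>" "[]"] \<pi>_one by (simp add: F_simps(4) kappa_coeff_Nil \<sigma>_Units)
  qed
qed

theorem twisted_algebra_presentation:
  assumes pres: "is_presentation k X P A x"
    and x: "\<And>j. j \<in> X \<Longrightarrow> x j \<in> D (g j)"
    and graded: "graded_submodule k G F (free_grading k G X g) (module_span k F P)"
  shows "is_presentation k X (\<kappa> ` P) T x"
proof -
  note [simp del] = F_simps in_lists_conv_set
  have P: "P \<subseteq> carrier F"
    using pres unfolding is_presentation_def F_def[symmetric] by blast
  have KP: "\<kappa> ` P \<subseteq> carrier F" using P kappa_closed by blast
  obtain \<pi> where hom: "\<pi> \<in> ring_hom F A"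
    and lin: "\<And>c f. c \<in> carrier k \<Longrightarrow> f \<in> carrier F \<Longrightarrow> \<pi> (c \<odot>\<^bsub>F\<^esub> f) = c \<odot>\<^bsub>A\<^esub> \<pi> f"
    and surj: "\<pi> ` carrier F = carrier A"
    and ker: "{f \<in> carrier F. \<pi> f = \<zero>\<^bsub>A\<^esub>} = Idl\<^bsub>F\<^esub> P"
    and gen: "\<And>j. j \<in> X \<Longrightarrow> \<pi> (monomial k \<one>\<^bsub>k\<^esub> [j]) = x j"
    using is_presentationE[OF pres] by blast
  let ?\<pi> = "\<lambda>f. \<pi> (kappa_inv f)"
  have hom': "?\<pi> \<in> ring_hom F T"
    using gen x by (intro hom_twist hom lin) simp_all
  interpret T: assoc_algebra k T by (rule assoc_algebra_T)
  have kernel: "ideal {f \<in> carrier F. ?\<pi> f = \<zero>\<^bsub>T\<^esub>} F"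
    using ring_hom_ring.kernel_is_ideal[OF ring_hom_ringI2[OF F.ring_axioms T.ring_axioms hom']]
    unfolding a_kernel_def' .
  show ?thesis
  proof (rule is_presentationI[OF assoc_algebra_T KP hom'])
    show "?\<pi> (c \<odot>\<^bsub>F\<^esub> f) = c \<odot>\<^bsub>T\<^esub> ?\<pi> f" if "c \<in> carrier k" "f \<in> carrier F" for c f
      using that lin by (simp add: kappa_inv_smult kappa_inv_closed)
    show "?\<pi> ` carrier F = carrier T"
    proof -
      have "kappa_inv ` carrier F = carrier F"
        using kappa_inv_closed kappa_inv_kappa kappa_closed by (metis (no_types, lifting) image_subsetI image_eqI subsetI subset_antisym)
      then show ?thesis using surj by (metis T_simps(1) image_image)
    qed
    show "{f \<in> carrier F. ?\<pi> f = \<zero>\<^bsub>T\<^esub>} = Idl\<^bsub>F\<^esub> (\<kappa> ` P)"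
    proof (rule subset_antisym)
      have "\<kappa> ` P \<subseteq> {f \<in> carrier F. ?\<pi> f = \<zero>\<^bsub>T\<^esub>}"
      proof
        fix f assume "f \<in> \<kappa> ` P"
        then obtain p where p: "p \<in> P" and f: "f = \<kappa> p" by blast
        have "p \<in> Idl\<^bsub>F\<^esub> P" using p F.genideal_self[OF P] by blast
        then have "\<pi> p = \<zero>\<^bsub>A\<^esub>" using ker by blast
        moreover have "p \<in> carrier F" using p P by blast
        ultimately show "f \<in> {f \<in> carrier F. ?\<pi> f = \<zero>\<^bsub>T\<^esub>}" by (simp add: f kappa_inv_kappa kappa_closed)
      qed
      then show "Idl\<^bsub>F\<^esub> (\<kappa> ` P) \<subseteq> {f \<in> carrier F. ?\<pi> f = \<zero>\<^bsub>T\<^esub>}"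
        by (rule F.genideal_minimal[OF kernel])
      show "{f \<in> carrier F. ?\<pi> f = \<zero>\<^bsub>T\<^esub>} \<subseteq> Idl\<^bsub>F\<^esub> (\<kappa> ` P)"
      proof
        fix f assume "f \<in> {f \<in> carrier F. ?\<pi> f = \<zero>\<^bsub>T\<^esub>}"
        then have f: "f \<in> carrier F" and "\<pi> (kappa_inv f) = \<zero>\<^bsub>A\<^esub>" by simp_all
        then have "kappa_inv f \<in> Idl\<^bsub>F\<^esub> P" using ker kappa_inv_closed[OF f] by blast
        then have "\<kappa> (kappa_inv f) \<in> Idl\<^bsub>F\<^esub> (\<kappa> ` P)" by (rule kappa_genideal[OF P graded])
        then show "f \<in> Idl\<^bsub>F\<^esub> (\<kappa> ` P)" by (simp add: kappa_kappa_inv f)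
      qed
    qed
    show "?\<pi> (monomial k \<one>\<^bsub>k\<^esub> [j]) = x j" if j: "j \<in> X" for j
    proof -
      have "coeff [j] = \<one>\<^bsub>k\<^esub>" by (simp add: kappa_coeff_def)
      then show ?thesis using j gen by (simp add: kappa_inv_monomial)
    qed
  qed
qed

end

theorem theorem3p5:
  fixes k :: "('k, 'm) ring_scheme"
    and G :: "('g, 'n) monoid_scheme"
    and \<sigma> :: "'g \<Rightarrow> 'g \<Rightarrow> 'k"
    and A :: "('k, 'a, 'c) module_scheme"
    and D :: "'g \<Rightarrow> 'a set"
    and n :: nat
    and g :: "nat \<Rightarrow> 'g"
    and x :: "nat \<Rightarrow> 'a"
    and I :: "'i set"
    and p :: "'i \<Rightarrow> nat list \<Rightarrow> 'k"
  assumes "cring k" and "\<one>\<^bsub>k\<^esub> \<noteq> \<zero>\<^bsub>k\<^esub>"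
    and "group G"
    and "group_two_cocycle k G \<sigma>"
    and "graded_algebra k A G D"
    and "\<And>j. j \<in> {1..n} \<Longrightarrow> g j \<in> carrier G"
    and "\<And>j. j \<in> {1..n} \<Longrightarrow> x j \<in> D (g j)"
    and "is_presentation k {1..n} (p ` I) A x"
    and "graded_submodule k G (free_algebra k {1..n}) (free_grading k G {1..n} g)
           (module_span k (free_algebra k {1..n}) (p ` I))"
  shows "is_presentation k {1..n} ((\<lambda>i. kappa k G \<sigma> g (p i)) ` I) (twisted_algebra k G \<sigma> A D) x \<and>
    (comm_group G \<longrightarrow>
      (\<forall>i\<in>{1..n}. \<forall>j\<in>{1..n}. i \<noteq> j \<longrightarrow> x i \<otimes>\<^bsub>A\<^esub> x j = x j \<otimes>\<^bsub>A\<^esub> x i \<longrightarrow>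
        x i \<otimes>\<^bsub>twisted_algebra k G \<sigma> A D\<^esub> x j =
          b_sigma k \<sigma> (g j) (g i) \<odot>\<^bsub>twisted_algebra k G \<sigma> A D\<^esub> (x j \<otimes>\<^bsub>twisted_algebra k G \<sigma> A D\<^esub> x i)))"
proof -
  have "assoc_algebra k A" using assms(5) by (rule graded_algebra.axioms)
  then interpret tw: twisted_presentation k "{1..n}" "free_algebra k {1..n}" A G D \<sigma> "twisted_algebra k G \<sigma> A D" g
    using assms(1,3,4,5,6)
    by (intro twisted_presentation.intro free_algebra_on.intro twisted_graded_algebra.intro
        twisted_graded_algebra_axioms.intro twisted_presentation_axioms.intro)
  have pres: "is_presentation k {1..n} ((\<lambda>i. kappa k G \<sigma> g (p i)) ` I) (twisted_algebra k G \<sigma> A D) x"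
    using tw.twisted_algebra_presentation[OF assms(8,7,9)] by (simp add: image_image)
  have "x i \<otimes>\<^bsub>twisted_algebra k G \<sigma> A D\<^esub> x j =
      b_sigma k \<sigma> (g j) (g i) \<odot>\<^bsub>twisted_algebra k G \<sigma> A D\<^esub> (x j \<otimes>\<^bsub>twisted_algebra k G \<sigma> A D\<^esub> x i)"
    if i: "i \<in> {1..n}" and j: "j \<in> {1..n}" and comm: "x i \<otimes>\<^bsub>A\<^esub> x j = x j \<otimes>\<^bsub>A\<^esub> x i" for i j
  proof -
    note gi = assms(6)[OF i] and gj = assms(6)[OF j]
    let ?s = "\<sigma> (g i) (g j)" and ?t = "\<sigma> (g j) (g i)"
    have t: "?t \<in> Units k" and s: "?s \<in> carrier k" using gi gj tw.\<sigma>_Units by simp_all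
    have ji: "x j \<otimes>\<^bsub>A\<^esub> x i \<in> carrier A"
      using tw.D_carrier[OF gi assms(7)[OF i]] tw.D_carrier[OF gj assms(7)[OF j]] by simp
    have "b_sigma k \<sigma> (g j) (g i) \<odot>\<^bsub>A\<^esub> (?t \<odot>\<^bsub>A\<^esub> (x j \<otimes>\<^bsub>A\<^esub> x i)) = (?s \<otimes>\<^bsub>k\<^esub> inv\<^bsub>k\<^esub> ?t \<otimes>\<^bsub>k\<^esub> ?t) \<odot>\<^bsub>A\<^esub> (x j \<otimes>\<^bsub>A\<^esub> x i)"
      using s t ji by (simp add: b_sigma_def tw.A.smult_assoc1 tw.k.Units_closed)
    also have "\<dots> = ?s \<odot>\<^bsub>A\<^esub> (x i \<otimes>\<^bsub>A\<^esub> x j)" using s t by (simp add: tw.k.m_assoc tw.k.Units_closed comm)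
    finally show ?thesis
      using tw.T_mult_homogeneous[OF gi gj assms(7)[OF i] assms(7)[OF j]]
        tw.T_mult_homogeneous[OF gj gi assms(7)[OF j] assms(7)[OF i]] by simp
  qed
  then show ?thesis using pres by blast
qed

end
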